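(* Fix an integer $K\ge 2$ and constants $a,b>0$ and $s\in[0,1]$, and let $(G_1,G_2,\ldots,G_K)\sim \mathrm{CSBM}(n,a\frac{\log n}{n},b\frac{\log n}{n},s)$, with latent community labels $\boldsymbol{\sigma^*}\in\{+1,-1\}^n$. Suppose that either $$\left(1-(1-s)^K\right)\mathrm{D}_+(a,b)<1$$ or $$s\left(1-(1-s)^{K-1}\right)\mathrm{T}_c(a,b)+s(1-s)^{K-1}\mathrm{D}_+(a,b)<1 .$$ Then exact community recovery is impossible: for any estimator $\widetilde{\boldsymbol\sigma}=\widetilde{\boldsymbol\sigma}(G_1,\ldots,G_K)\in\{+1,-1\}^n$, $$\lim_{n\to\infty}\mathbb{P}\left(\mathsf{ov}(\widetilde{\boldsymbol\sigma},\boldsymbol{\sigma^*})=1\right)=0 .$$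
   Context: $\mathrm{D}_+(a,b):=(\sqrt a-\sqrt b)^2/2$ and $\mathrm{T}_c(a,b):=(a+b)/2$. SBM: $G\sim\mathrm{SBM}(n,p,q)$ has vertex set $[n]$; labels $\sigma^*(i)\in\{+1,-1\}$, $i\in[n]$, are i.i.d. uniform; given $\boldsymbol{\sigma^*}$, each pair of distinct vertices $\{i,j\}$ is independently an edge with probability $p$ if $\sigma^*(i)=\sigma^*(j)$ and with probability $q$ otherwise. Correlated SBMs: $(G_1,\ldots,G_K)\sim\mathrm{CSBM}(n,p,q,s)$ is generated as follows. Sample a parent graph $G_0\sim\mathrm{SBM}(n,p,q)$ with labels $\boldsymbol{\sigma^*}$. Given $G_0$, form $G_1',\ldots,G_K'$ independently, each by keeping every edge of $G_0$ independently with probability $s$ (non-edges stay non-edges). Let $\pi^*_{12},\ldots,\pi^*_{1K}$ be i.i.d. uniformly random permutations of $[n]$, independent of everything else. Set $G_1:=G_1'$ and, for $i\ge 2$, let $G_i:=\pi^*_{1i}(G_i')$ be $G_i'$ with each vertex $j$ relabeled $\pi^*_{1i}(j)$. Only $G_1,\ldots,G_K$ are observed; $\boldsymbol{\sigma^*}$ is the labeling of the vertices of $G_1$ (equivalently $G_0$). Overlap: $\mathsf{ov}(\boldsymbol\sigma,\boldsymbol\sigma'):=\frac1n\left|\sum_{i=1}^n\sigma(i)\sigma'(i)\right|$. An estimator is a function of the observed graphs (it may depend on $n,a,b,s,K$). Here $n$ is large enough that $a\frac{\log n}{n},b\frac{\log n}{n}\in[0,1]$, and $K,a,b,s$ do not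 depend on $n$. *)

theory Defs
  imports "HOL-Probability.Probability"
begin

definition D_plus :: "real \<Rightarrow> real \<Rightarrow> real" where
  "D_plus a b = (sqrt a - sqrt b)\<^sup>2 / 2"

definition T_c :: "real \<Rightarrow> real \<Rightarrow> real" where
  "T_c a b = (a + b) / 2"

(* A simple graph on {1..n} is represented by its edge set, a subset of vertex_pairs n. *)
type_synonym graph = "nat set set"

definition vertex_pairs :: "nat \<Rightarrow> nat set set" where
  "vertex_pairs n = {e. e \<subseteq> {1..n} \<and> card e = 2}"

definition relabel :: "(nat \<Rightarrow> nat) \<Rightarrow> graph \<Rightarrow> graph" where
  "relabel \<pi> G = (\<lambda>e. \<pi> ` e) ` G"

(* Each element e of the finite set A is kept independently with probability w e. *)
definition random_subset :: "'e set \<Rightarrow> ('e \<Rightarrow> real) \<Rightarrow> 'e set pmf" where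
  "random_subset A w =
     map_pmf (\<lambda>f. {e \<in> A. f e}) (Pi_pmf A False (\<lambda>e. bernoulli_pmf (w e)))"

(* Labels outside {1..n} are set to the dummy value 0. *)
definition uniform_labels :: "nat \<Rightarrow> (nat \<Rightarrow> int) pmf" where
  "uniform_labels n = Pi_pmf {1..n} 0 (\<lambda>_. pmf_of_set {1, -1})"

(* The second component is the graph; its edge {i,j} has i and j in the same community
   iff \<sigma> is constant on it. Note that bernoulli_pmf truncates its parameter to [0,1]. *)
definition SBM :: "nat \<Rightarrow> real \<Rightarrow> real \<Rightarrow> ((nat \<Rightarrow> int) \<times> graph) pmf" where
  "SBM n p q = do {
     \<sigma> \<leftarrow> uniform_labels n;
     G \<leftarrow> random_subset (vertex_pairs n)
            (\<lambda>e. if \<forall>i\<in>e. \<forall>j\<in>e. \<sigma> i = \<sigma> j then p else q);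
     return_pmf (\<sigma>, G)
   }"

(* Joint law of the labels and of the observed graphs G 1, ..., G K. At indices outside {1..K},
   G takes the constant value {}, so it carries no further information. The permutation of
   index k is the one relating the first graph to the k-th one. *)
definition CSBM :: "nat \<Rightarrow> nat \<Rightarrow> real \<Rightarrow> real \<Rightarrow> real \<Rightarrow> ((nat \<Rightarrow> int) \<times> (nat \<Rightarrow> graph)) pmf" where
  "CSBM K n p q s = do {
     (\<sigma>, G0) \<leftarrow> SBM n p q;
     G' \<leftarrow> Pi_pmf {1..K} {} (\<lambda>_. random_subset G0 (\<lambda>_. s));
     \<pi> \<leftarrow> Pi_pmf {2..K} id (\<lambda>_. pmf_of_set {\<pi>. \<pi> permutes {1..n}});
     return_pmf (\<sigma>, \<lambda>k. if k \<in> {2..K} then relabel (\<pi> k) (G' k) else G' k)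
   }"

definition ov :: "nat \<Rightarrow> (nat \<Rightarrow> int) \<Rightarrow> (nat \<Rightarrow> int) \<Rightarrow> real" where
  "ov n \<sigma> \<sigma>' = \<bar>\<Sum>i=1..n. real_of_int (\<sigma> i * \<sigma>' i)\<bar> / real n"

end

theory Submission
  imports Defs "HOL-Real_Asymp.Real_Asymp"
begin

text \<open>
  Fix a set \<open>T\<close> of graph indices, namely \<open>T = {}\<close> under the first hypothesis and \<open>T = {2..K}\<close> under the
  second. Exchanging two vertices \<open>i\<close> and \<open>j\<close> with opposite labels in the labelling and in the graphs with
  index in \<open>T\<close>, while composing the permutations of the latter with the transposition of \<open>i\<close> and \<open>j\<close>,
  leaves the observed graphs unchanged. If no edge at \<open>i\<close> or \<open>j\<close> in a graph outside \<open>T\<close> is shared with a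
  graph in \<open>T\<close>, and if each of the two vertices has in the graphs outside \<open>T\<close> equally many neighbours of
  either label, the exchange does not decrease the likelihood. An estimator is right for at most two of the
  labellings (opposite to each other) compatible with an observation, so the probability of being right
  while there are \<open>M\<close> such pairs is at most \<open>2 / M\<close>.

  A vertex has the required property with probability at least \<open>n powr (- \<theta>)\<close> for some \<open>\<theta> < 1\<close>. Among
  \<open>M\<close> blocks of \<open>n powr \<kappa>\<close> vertices each, \<open>\<theta> < \<kappa> < 1\<close>, every block thus contains such vertices of both labels
  with probability tending to one: edges from the blocks to the rest are independent for different
  vertices, and a given vertex has no edge into the blocks with probability tending to one.
\<close>

subsection \<open>The joint law without the parent graph\<close>

text \<open>The count \<open>m\<close> is prescribed and common to all good vertices, so the odds
  ratios cancel for any two of them and nothing about typical degrees is needed. Its choice fixes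
  the exponent. Write L = ln n. A parent edge is visible outside \<open>T\<close> with probability
  \<eta> = 1 - (1-s)^(K - card T), and visible there but not in \<open>T\<close> with probability
  \<alpha> = (1-s)^card T - (1-s)^K. Having no edge visible outside \<open>T\<close> costs about exp
  (-\<eta> (a+b) L / 2). Having m edges of either kind instead changes this by a factor of about
  (\<alpha>^2 a b L^2 / 4)^m / (m!)^2, which is largest near m = \<alpha> sqrt(a b) L / 2 and there
  equals exp (\<alpha> sqrt(a b) L) up to powers of L. So every \<theta> above \<eta> (a+b)/2 -
  \<alpha> sqrt(a b) is admissible, and for \<open>T = {}\<close> and \<open>T = {2..K}\<close> this
  number is the left side of the first and of the second hypothesis. The exchange yields an
  inequality rather than an equality because a moved edge may land on a pair that already has edges
  in \<open>T\<close>. Graph 1 is never in \<open>T\<close>: it is not relabelled, so no permutation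
  could hide the exchange in it.\<close>

lemma random_subset_Collect:
  assumes "finite A"
  shows "random_subset A w = map_pmf Collect (Pi_pmf A False (\<lambda>e. bernoulli_pmf (w e)))"
  unfolding random_subset_def
proof (rule map_pmf_cong[OF refl])
  fix f assume "f \<in> set_pmf (Pi_pmf A False (\<lambda>e. bernoulli_pmf (w e)))"
  then have "\<forall>x. x \<notin> A \<longrightarrow> \<not> f x"
    using set_Pi_pmf_subset[OF assms, of False "\<lambda>e. bernoulli_pmf (w e)"] by auto
  then show "{e \<in> A. f e} = Collect f" by auto
qed

lemma pmf_random_subset:
  assumes "finite A"
  shows "pmf (random_subset A w) X =
           (if X \<subseteq> A then \<Prod>x\<in>A. pmf (bernoulli_pmf (w x)) (x \<in> X) else 0)"
proof -
  have "pmf (random_subset A w) (Collect (\<lambda>x. x \<in> X)) =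
          pmf (Pi_pmf A False (\<lambda>e. bernoulli_pmf (w e))) (\<lambda>x. x \<in> X)"
    unfolding random_subset_Collect[OF assms] by (rule pmf_map_inj') (auto intro: injI)
  then show ?thesis
    using assms by (auto simp: pmf_Pi)
qed

text \<open>Both sides describe one random 0/1 matrix with independent entries, read by columns and
  by rows; the point probabilities agree after interchanging two finite products.\<close>

lemma Pi_pmf_random_subset_transpose:
  assumes "finite I" "finite J"
  shows "map_pmf (\<lambda>c k. {e. k \<in> c e}) (Pi_pmf J {} (\<lambda>_. random_subset I (\<lambda>_. s))) =
         Pi_pmf I {} (\<lambda>_. random_subset J (\<lambda>_. s))"
proof (rule pmf_eqI)
  fix h :: "'a \<Rightarrow> 'b set"
  define f :: "('b \<Rightarrow> 'a set) \<Rightarrow> 'a \<Rightarrow> 'b set" where "f = (\<lambda>c k. {e. k \<in> c e})"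
  define c where "c = (\<lambda>e. {k. e \<in> h k})"
  have h: "h = f c" by (simp add: f_def c_def)
  have "inj f" by (rule injI) (auto simp: f_def fun_eq_iff set_eq_iff)
  let ?\<beta> = "\<lambda>k e. pmf (bernoulli_pmf s) (e \<in> h k)"
  let ?P = "\<forall>k e. e \<in> h k \<longrightarrow> k \<in> I \<and> e \<in> J"
  have "pmf (map_pmf f (Pi_pmf J {} (\<lambda>_. random_subset I (\<lambda>_. s)))) (f c) =
        (if \<forall>e. e \<notin> J \<longrightarrow> c e = {} then \<Prod>e\<in>J. if c e \<subseteq> I then \<Prod>k\<in>I. ?\<beta> k e else 0 else 0)"
    unfolding pmf_map_inj'[OF \<open>inj f\<close>]
    by (simp add: pmf_Pi[OF assms(2)] pmf_random_subset[OF assms(1)] c_def cong: if_cong)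
  also have "\<dots> = (if ?P then \<Prod>e\<in>J. \<Prod>k\<in>I. ?\<beta> k e else 0)"
  proof (cases ?P)
    case False
    then have "(\<exists>e\<in>J. \<not> c e \<subseteq> I) \<or> \<not> (\<forall>e. e \<notin> J \<longrightarrow> c e = {})" by (auto simp: c_def)
    then show ?thesis using assms False by (auto intro!: prod_zero)
  qed (auto simp: c_def intro!: prod.cong)
  also have "\<dots> = (if ?P then \<Prod>k\<in>I. \<Prod>e\<in>J. ?\<beta> k e else 0)"
    by (rule if_cong[OF refl prod.swap refl])
  also have "\<dots> = (if \<forall>k. k \<notin> I \<longrightarrow> h k = {} then \<Prod>k\<in>I. if h k \<subseteq> J then \<Prod>e\<in>J. ?\<beta> k e else 0 else 0)"
  proof (cases ?P)
    case False
    then have "(\<exists>k\<in>I. \<not> h k \<subseteq> J) \<or> \<not> (\<forall>k. k \<notin> I \<longrightarrow> h k = {})" by auto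
    then show ?thesis using assms False by (auto intro!: prod_zero)
  next
    case True
    then have 1: "\<forall>k. k \<notin> I \<longrightarrow> h k = {}" and 2: "\<And>k. k \<in> I \<Longrightarrow> h k \<subseteq> J" by blast+
    show ?thesis
      unfolding if_P[OF True] if_P[OF 1] by (rule prod.cong) (simp_all add: 2)
  qed
  also have "\<dots> = pmf (Pi_pmf I {} (\<lambda>_. random_subset J (\<lambda>_. s))) h"
    by (simp only: pmf_Pi[OF assms(1)] pmf_random_subset[OF assms(2)])
  finally show "pmf (map_pmf (\<lambda>c k. {e. k \<in> c e}) (Pi_pmf J {} (\<lambda>_. random_subset I (\<lambda>_. s)))) h =
     pmf (Pi_pmf I {} (\<lambda>_. random_subset J (\<lambda>_. s))) h"
    using h by (simp add: f_def)
qed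

text \<open>The parent graph is integrated out: each pair of vertices carries the set of indices of those
  graphs that contain it (before relabelling).\<close>

definition edge_law :: "nat \<Rightarrow> real \<Rightarrow> real \<Rightarrow> nat set pmf" where
  "edge_law K s w = do {
     b \<leftarrow> bernoulli_pmf w;
     if b then random_subset {1..K} (\<lambda>_. s) else return_pmf {}
   }"

definition edge_weight :: "real \<Rightarrow> real \<Rightarrow> (nat \<Rightarrow> int) \<Rightarrow> nat set \<Rightarrow> real" where
  "edge_weight p q \<sigma> e = (if \<forall>i\<in>e. \<forall>j\<in>e. \<sigma> i = \<sigma> j then p else q)"

definition pattern_law :: "nat \<Rightarrow> nat \<Rightarrow> real \<Rightarrow> real \<Rightarrow> real \<Rightarrow> (nat \<Rightarrow> int) \<Rightarrow> (nat set \<Rightarrow> nat set) pmf" where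
  "pattern_law K n p q s \<sigma> =
     Pi_pmf (vertex_pairs n) {} (\<lambda>e. edge_law K s (edge_weight p q \<sigma> e))"

definition perm_law :: "nat \<Rightarrow> nat \<Rightarrow> (nat \<Rightarrow> nat \<Rightarrow> nat) pmf" where
  "perm_law K n = Pi_pmf {2..K} id (\<lambda>_. pmf_of_set {\<pi>. \<pi> permutes {1..n}})"

definition layer :: "nat \<Rightarrow> (nat set \<Rightarrow> nat set) \<Rightarrow> nat \<Rightarrow> graph" where
  "layer n c k = {e \<in> vertex_pairs n. k \<in> c e}"

definition observed :: "nat \<Rightarrow> nat \<Rightarrow> (nat set \<Rightarrow> nat set) \<Rightarrow> (nat \<Rightarrow> nat \<Rightarrow> nat) \<Rightarrow> nat \<Rightarrow> graph" where
  "observed K n c \<pi> k = (if k \<in> {2..K} then relabel (\<pi> k) (layer n c k) else layer n c k)"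

lemma finite_vertex_pairs [simp, intro]: "finite (vertex_pairs n)"
  unfolding vertex_pairs_def by (rule finite_subset[of _ "Pow {1..n}"]) auto

text \<open>For a fixed parent graph, independent copies are the same as independent patterns on its
  edges, with the constant pattern \<open>{}\<close> on non-edges. Averaging over the parent graph
  can then be done separately for each pair, since its edges are independent.\<close>

lemma random_subset_layers:
  assumes "finite A"
  shows "bind_pmf (random_subset A w) (\<lambda>G0. Pi_pmf {1..K} {} (\<lambda>_. random_subset G0 (\<lambda>_. s))) =
         map_pmf (\<lambda>c k. {e \<in> A. k \<in> c e}) (Pi_pmf A {} (\<lambda>e. edge_law K s (w e)))"
proof -
  let ?B = "Pi_pmf A False (\<lambda>e. bernoulli_pmf (w e))"
  have "Pi_pmf {1..K} {} (\<lambda>_. random_subset {e\<in>A. f e} (\<lambda>_. s)) =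
        map_pmf (\<lambda>c k. {e \<in> A. k \<in> c e}) (Pi_pmf {e\<in>A. f e} {} (\<lambda>_. random_subset {1..K} (\<lambda>_. s)))"
    (is "_ = map_pmf _ ?P") for f
  proof -
    have "map_pmf (\<lambda>c k. {e \<in> A. k \<in> c e}) ?P = map_pmf (\<lambda>c k. {e. k \<in> c e}) ?P"
    proof (rule map_pmf_cong[OF refl])
      fix c assume "c \<in> set_pmf ?P"
      then have "\<forall>e. e \<notin> {e\<in>A. f e} \<longrightarrow> c e = {}"
        using set_Pi_pmf_subset[of "{e\<in>A. f e}" "{}" "\<lambda>_. random_subset {1..K} (\<lambda>_. s)"] assms
        by auto
      then show "(\<lambda>k. {e \<in> A. k \<in> c e}) = (\<lambda>k. {e. k \<in> c e})" by fastforce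
    qed
    then show ?thesis using assms by (simp add: Pi_pmf_random_subset_transpose)
  qed
  then have "bind_pmf (random_subset A w) (\<lambda>G0. Pi_pmf {1..K} {} (\<lambda>_. random_subset G0 (\<lambda>_. s))) =
     map_pmf (\<lambda>c k. {e \<in> A. k \<in> c e})
       (bind_pmf ?B (\<lambda>f. Pi_pmf {e\<in>A. f e} {} (\<lambda>_. random_subset {1..K} (\<lambda>_. s))))"
    by (simp add: random_subset_def[of A] bind_map_pmf map_bind_pmf)
  also have "bind_pmf ?B (\<lambda>f. Pi_pmf {e\<in>A. f e} {} (\<lambda>_. random_subset {1..K} (\<lambda>_. s))) =
     bind_pmf ?B (\<lambda>f. Pi_pmf A {} (\<lambda>e. if f e then random_subset {1..K} (\<lambda>_. s) else return_pmf {}))"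
    using assms by (simp add: Pi_pmf_if_set)
  also have "\<dots> = Pi_pmf A {} (\<lambda>e. edge_law K s (w e))"
    unfolding edge_law_def by (rule Pi_pmf_bind[symmetric, OF assms])
  finally show ?thesis .
qed

text \<open>The permutations are kept next to the patterns because the exchange acts on both, and
  only their combination determines the observation.\<close>

definition latent ::
  "nat \<Rightarrow> nat \<Rightarrow> real \<Rightarrow> real \<Rightarrow> real \<Rightarrow> ((nat \<Rightarrow> int) \<times> (nat set \<Rightarrow> nat set) \<times> (nat \<Rightarrow> nat \<Rightarrow> nat)) pmf" where
  "latent K n p q s = do {
     \<sigma> \<leftarrow> uniform_labels n;
     c \<leftarrow> pattern_law K n p q s \<sigma>;
     \<pi> \<leftarrow> perm_law K n;
     return_pmf (\<sigma>, c, \<pi>)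
   }"

lemma CSBM_latent:
  "CSBM K n p q s = map_pmf (\<lambda>(\<sigma>, c, \<pi>). (\<sigma>, observed K n c \<pi>)) (latent K n p q s)"
proof -
  let ?A = "vertex_pairs n"
  have "CSBM K n p q s = do {
     \<sigma> \<leftarrow> uniform_labels n;
     G' \<leftarrow> bind_pmf (random_subset ?A (edge_weight p q \<sigma>))
             (\<lambda>G0. Pi_pmf {1..K} {} (\<lambda>_. random_subset G0 (\<lambda>_. s)));
     \<pi> \<leftarrow> perm_law K n;
     return_pmf (\<sigma>, \<lambda>k. if k \<in> {2..K} then relabel (\<pi> k) (G' k) else G' k)}"
    by (simp add: CSBM_def SBM_def bind_assoc_pmf bind_return_pmf perm_law_def edge_weight_def[abs_def])
  then show ?thesis
    unfolding random_subset_layers[OF finite_vertex_pairs] latent_def pattern_law_def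
    by (simp add: map_bind_pmf bind_map_pmf observed_def[abs_def] layer_def cong: if_cong)
qed

text \<open>This factorisation lets the effect of an exchange be checked separately on labels,
  patterns and permutations.\<close>

lemma pmf_latent:
  "pmf (latent K n p q s) (\<sigma>, c, \<pi>) =
     pmf (uniform_labels n) \<sigma> * pmf (pattern_law K n p q s \<sigma>) c * pmf (perm_law K n) \<pi>"
proof -
  have "latent K n p q s = bind_pmf (uniform_labels n)
     (\<lambda>\<sigma>. map_pmf (Pair \<sigma>) (pair_pmf (pattern_law K n p q s \<sigma>) (perm_law K n)))"
    unfolding latent_def by (simp add: pair_pmf_def map_bind_pmf)
  moreover have "pmf (map_pmf (Pair \<sigma>') (pair_pmf (pattern_law K n p q s \<sigma>') (perm_law K n))) (\<sigma>, c, \<pi>) =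
      (if \<sigma>' = \<sigma> then pmf (pattern_law K n p q s \<sigma>) c * pmf (perm_law K n) \<pi> else 0)" for \<sigma>'
    by (cases "\<sigma>' = \<sigma>") (auto simp: pmf_map_inj' inj_def pmf_pair intro!: pmf_map_outside)
  ultimately have "pmf (latent K n p q s) (\<sigma>, c, \<pi>) = (\<integral>\<sigma>'. (if \<sigma>' = \<sigma> then
      pmf (pattern_law K n p q s \<sigma>) c * pmf (perm_law K n) \<pi> else 0) \<partial>uniform_labels n)"
    by (simp only: pmf_bind)
  also have "\<dots> = (\<Sum>\<sigma>'\<in>{\<sigma>}. pmf (uniform_labels n) \<sigma>' *\<^sub>R (if \<sigma>' = \<sigma> then 
      pmf (pattern_law K n p q s \<sigma>) c * pmf (perm_law K n) \<pi> else 0))"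
    by (rule integral_measure_pmf) (auto split: if_splits)
  finally show ?thesis by simp
qed

subsection \<open>Likelihood of an exchange of two vertices\<close>

lemma pmf_edge_law:
  assumes "0 \<le> w" "w \<le> 1" "0 \<le> s" "s \<le> 1"
  shows "pmf (edge_law K s w) X =
           (if X = {} then 1 - w else 0) +
           w * (if X \<subseteq> {1..K} then s ^ card X * (1 - s) ^ (K - card X) else 0)"
proof -
  have "(\<Prod>x\<in>{1..K}. pmf (bernoulli_pmf s) (x \<in> X)) = s ^ card X * (1 - s) ^ (K - card X)"
    if "X \<subseteq> {1..K}"
  proof -
    have "(\<Prod>x\<in>{1..K}. pmf (bernoulli_pmf s) (x \<in> X)) =
          (\<Prod>x\<in>{1..K} \<inter> {x. x \<in> X}. s) * (\<Prod>x\<in>{1..K} \<inter> - {x. x \<in> X}. 1 - s)"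
      using assms by (subst prod.If_cases[symmetric]) (auto intro!: prod.cong)
    moreover have "{1..K} \<inter> {x. x \<in> X} = X" "{1..K} \<inter> - {x. x \<in> X} = {1..K} - X" using that by auto
    moreover have "card ({1..K} - X) = K - card X"
      using that by (simp add: card_Diff_subset finite_subset)
    ultimately show ?thesis by simp
  qed
  then show ?thesis
    using assms by (simp add: edge_law_def pmf_bind pmf_random_subset)
qed

lemma set_pmf_edge_law: "set_pmf (edge_law K s w) \<subseteq> Pow {1..K}"
proof -
  have "set_pmf (random_subset {1..K} (\<lambda>_. s)) \<subseteq> Pow {1..K}"
    by (auto simp: random_subset_def)
  then show ?thesis by (auto simp: edge_law_def split: if_splits)
qed

text \<open>An edge that is present only in layers outside \<open>T\<close> is moved from one pair of vertices to another.
  If the target pair is empty, this is an equality: the likelihood changes by the ratio of the odds.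
  Creating an overlap with layers in \<open>T\<close> only increases the likelihood.\<close>

lemma edge_law_move:
  assumes w: "0 < w" "w < 1" "0 < v" "v < 1" and s: "0 \<le> s" "s \<le> 1"
    and X: "X \<subseteq> {1..K}" "X \<noteq> {}" and Y: "Y \<subseteq> {1..K}" and XY: "X \<inter> Y = {}"
  defines "\<phi> \<equiv> \<lambda>w. pmf (edge_law K s w)"
  shows "\<phi> w X * \<phi> v Y * (v / \<phi> v {}) \<le> \<phi> w {} * \<phi> v (X \<union> Y) * (w / \<phi> w {})"
proof -
  have pos: "\<phi> w {} > 0" "\<phi> v {} > 0"
    using w s by (auto simp: \<phi>_def pmf_edge_law intro!: add_pos_nonneg)
  \<comment> \<open>\<open>g Z\<close> is the probability that a parent edge survives in exactly the
    copies \<open>Z\<close>; hence \<open>\<phi> u Z\<close> is linear in \<open>u\<close> for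
    nonempty \<open>Z\<close>.\<close>
  define g where "g = (\<lambda>Z :: nat set. s ^ card Z * (1 - s) ^ (K - card Z))"
  have g: "\<phi> u Z = u * g Z" if "Z \<noteq> {}" "Z \<subseteq> {1..K}" "0 < u" "u < 1" for u Z
    using that s by (simp add: \<phi>_def pmf_edge_law g_def)
  have fin: "finite X" "finite Y" using X Y finite_subset by blast+
  show ?thesis
  proof (cases "Y = {}")
    case True
    then show ?thesis using pos g[of X w] g[of X v] X w by simp
  next
    case False
    have card: "card X + card Y = card (X \<union> Y)" "card (X \<union> Y) \<le> K"
      using card_Un_disjoint[OF fin XY] card_mono[of "{1..K}" "X \<union> Y"] X Y by simp_all
    \<comment> \<open>The quotient of the two sides is the conditional probability that a parent
      edge exists given that no copy shows it, hence at most 1.\<close>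
    have "v * (1 - s) ^ K \<le> \<phi> v {}"
      using w s by (simp add: \<phi>_def pmf_edge_law)
    then have le: "(1 - s) ^ K * (v / \<phi> v {}) \<le> 1"
      using pos by (simp add: field_simps)
    \<comment> \<open>Two disjoint nonempty patterns on two pairs need two parent edges. Merged on
      one pair they need the same retentions, except that the \<open>K\<close> deletions on the
      vacated pair are saved.\<close>
    have gg: "g X * g Y = g (X \<union> Y) * (1 - s) ^ K"
    proof -
      have "(K - card X) + (K - card Y) = (K - card (X \<union> Y)) + K"
        using card by linarith
      then have "(1 - s) ^ (K - card X) * (1 - s) ^ (K - card Y) =
                 (1 - s) ^ (K - card (X \<union> Y)) * (1 - s) ^ K"
        by (simp only: power_add[symmetric])
      moreover have "s ^ card X * s ^ card Y = s ^ card (X \<union> Y)"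
        using card by (simp only: power_add[symmetric])
      ultimately have "(s ^ card X * s ^ card Y) * ((1 - s) ^ (K - card X) * (1 - s) ^ (K - card Y)) =
        s ^ card (X \<union> Y) * ((1 - s) ^ (K - card (X \<union> Y)) * (1 - s) ^ K)" by (simp only:)
      then show ?thesis unfolding g_def by (simp only: mult_ac)
    qed
    have "\<phi> w X * \<phi> v Y * (v / \<phi> v {}) = w * v * (g X * g Y) * (v / \<phi> v {})"
      using g[of X w] g[of Y v] X Y w False by simp
    also have "\<dots> = w * v * g (X \<union> Y) * ((1 - s) ^ K * (v / \<phi> v {}))"
      unfolding gg by (simp add: mult_ac)
    also have "\<dots> \<le> w * v * g (X \<union> Y) * 1"
      using le w s by (intro mult_left_mono) (auto simp: g_def)
    also have "\<dots> = \<phi> w {} * \<phi> v (X \<union> Y) * (w / \<phi> w {})"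
      using pos g[of "X \<union> Y" v] X Y w by simp
    finally show ?thesis .
  qed
qed

text \<open>The weight \<open>\<kappa>\<close> charges the odds of a pair to each pattern visible
  outside \<open>T\<close>; this is exactly the factor by which moving such a pattern between pairs
  of parameters \<open>w\<close> and \<open>v\<close> changes the likelihood. If both or neither of
  the patterns move, equality holds. If one moves, it is disjoint from the other, which lies in
  \<open>T\<close>, and \<open>edge_law_move\<close> applies.\<close>

lemma edge_law_exchange:
  assumes w: "0 < w" "w < 1" "0 < v" "v < 1" and s: "0 \<le> s" "s \<le> 1"
    and X: "X \<subseteq> {1..K}" "X \<subseteq> T \<or> X \<inter> T = {}" and Y: "Y \<subseteq> {1..K}" "Y \<subseteq> T \<or> Y \<inter> T = {}"
  defines "\<phi> \<equiv> \<lambda>w. pmf (edge_law K s w)"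
  defines "\<kappa> \<equiv> \<lambda>w Z. if \<not> Z \<subseteq> T then w / \<phi> w {} else 1"
  shows "(\<phi> w X * \<phi> v Y) * (\<kappa> v X * \<kappa> w Y) \<le>
         (\<phi> w ((Y - T) \<union> (X \<inter> T)) * \<phi> v ((X - T) \<union> (Y \<inter> T))) * (\<kappa> w X * \<kappa> v Y)"
proof -
  have diff: "Z - T = (if Z \<subseteq> T then {} else Z)" and int: "Z \<inter> T = (if Z \<subseteq> T then Z else {})"
    if "Z \<subseteq> T \<or> Z \<inter> T = {}" for Z using that by auto
  note d = diff[OF X(2)] diff[OF Y(2)] int[OF X(2)] int[OF Y(2)]
  consider "X \<subseteq> T" "Y \<subseteq> T" | "\<not> X \<subseteq> T" "\<not> Y \<subseteq> T" | "\<not> X \<subseteq> T" "Y \<subseteq> T" | "X \<subseteq> T" "\<not> Y \<subseteq> T" by blast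
  then show ?thesis
  proof cases
    case 1 then show ?thesis by (simp add: d \<kappa>_def)
  next
    case 2
    then have "X \<noteq> {}" "Y \<noteq> {}" by auto
    then have "\<phi> w X * \<phi> v Y = \<phi> w Y * \<phi> v X"
      using w s X Y by (simp add: \<phi>_def pmf_edge_law)
    moreover have "\<kappa> v X * \<kappa> w Y = \<kappa> w X * \<kappa> v Y" using 2 by (simp add: \<kappa>_def mult.commute)
    ultimately show ?thesis using 2 by (simp only: d) simp
  next
    case 3
    then have "X \<noteq> {}" "X \<inter> Y = {}" using X by auto
    then show ?thesis using edge_law_move[of w v s X K Y] w s X Y 3
      by (simp add: d \<kappa>_def \<phi>_def)
  next
    case 4
    then have "Y \<noteq> {}" "Y \<inter> X = {}" using Y by auto
    then show ?thesis using edge_law_move[of v w s Y K X] w s X Y 4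
      by (simp add: d \<kappa>_def \<phi>_def mult_ac Un_commute)
  qed
qed

text \<open>The permutations of the layers in \<open>T\<close> are adjusted so that the observed graphs stay the same.\<close>

fun swap ::
  "nat set \<Rightarrow> nat \<Rightarrow> nat \<Rightarrow> (nat \<Rightarrow> int) \<times> (nat set \<Rightarrow> nat set) \<times> (nat \<Rightarrow> nat \<Rightarrow> nat) \<Rightarrow>
   (nat \<Rightarrow> int) \<times> (nat set \<Rightarrow> nat set) \<times> (nat \<Rightarrow> nat \<Rightarrow> nat)" where
  "swap T i j (\<sigma>, c, \<pi>) =
     (\<sigma> \<circ> Transposition.transpose i j,
      \<lambda>e. (c e - T) \<union> (c (Transposition.transpose i j ` e) \<inter> T),
      \<lambda>k. if k \<in> T then \<pi> k \<circ> Transposition.transpose i j else \<pi> k)"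

text \<open>Exchanging two good vertices with opposite labels does not decrease the likelihood: since
  each has \<open>m\<close> neighbours of either label, the odds ratios of the moved edges cancel.\<close>

definition good :: "nat set \<Rightarrow> nat set \<Rightarrow> nat set \<Rightarrow> nat \<Rightarrow> (nat \<Rightarrow> int) \<Rightarrow> (nat set \<Rightarrow> nat set) \<Rightarrow> nat \<Rightarrow> bool" where
  "good T S R m \<sigma> c i \<longleftrightarrow>
     (\<forall>u\<in>S - {i}. c {i, u} \<subseteq> T) \<and> (\<forall>u\<in>R. c {i, u} \<subseteq> T \<or> c {i, u} \<inter> T = {}) \<and>
     card {u \<in> R. \<sigma> u = \<sigma> i \<and> \<not> c {i, u} \<subseteq> T} = m \<and>
     card {u \<in> R. \<sigma> u \<noteq> \<sigma> i \<and> \<not> c {i, u} \<subseteq> T} = m"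

lemma prod_if_power:
  assumes "finite R"
  shows "(\<Prod>u\<in>R. if h u then (if P u then x else y) else 1) =
           (x :: 'b :: comm_semiring_1) ^ card {u \<in> R. P u \<and> h u} * y ^ card {u \<in> R. \<not> P u \<and> h u}"
proof -
  have "(\<Prod>u\<in>R. if h u then (if P u then x else y) else 1) = 
        (\<Prod>u\<in>R. (if P u \<and> h u then x else 1) * (if \<not> P u \<and> h u then y else 1))"
    by (intro prod.cong) auto
  also have "\<dots> = x ^ card {u \<in> R. P u \<and> h u} * y ^ card {u \<in> R. \<not> P u \<and> h u}"
    using assms by (simp add: prod.distrib prod.If_cases Int_def)
  finally show ?thesis .
qed

lemma transpose_image_vertex_pairs:
  assumes "i \<in> {1..n}" "j \<in> {1..n}" "e \<in> vertex_pairs n"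
  shows "Transposition.transpose i j ` e \<in> vertex_pairs n"
proof -
  have "Transposition.transpose i j ` e \<subseteq> {1..n}"
    using assms by (fastforce simp: vertex_pairs_def Transposition.transpose_def)
  then show ?thesis using assms(3) by (simp add: vertex_pairs_def card_image)
qed

lemma transpose_image_image [simp]: "Transposition.transpose i j ` Transposition.transpose i j ` e = e"
  by (simp add: image_comp)

text \<open>A transposition fixes \<open>{i, j}\<close> and every pair avoiding both vertices; the
  remaining pairs come in couples \<open>{i, u}\<close>, \<open>{j, u}\<close> that it interchanges.
  Only these couples matter when likelihoods before and after an exchange are compared.\<close>

lemma prod_vertex_pairs_split:
  assumes ij: "i \<in> {1..n}" "j \<in> {1..n}" "i \<noteq> j"
  defines "V \<equiv> {1..n} - {i, j}"
  obtains A0 where "\<And>f. (\<Prod>e\<in>vertex_pairs n. f e :: real) = (\<Prod>e\<in>A0. f e) * (\<Prod>u\<in>V. f {i, u} * f {j, u})"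
    and "\<And>e. e \<in> A0 \<Longrightarrow> Transposition.transpose i j ` e = e"
proof -
  define Ai where "Ai = (\<lambda>u. {i, u}) ` V"
  define Aj where "Aj = (\<lambda>u. {j, u}) ` V"
  define A0 where "A0 = vertex_pairs n - (Ai \<union> Aj)"
  have fin: "finite V" "finite Ai" "finite Aj" "finite A0" by (auto simp: V_def Ai_def Aj_def A0_def)
  have inj: "inj_on (\<lambda>u. {i, u}) V" "inj_on (\<lambda>u. {j, u}) V"
    by (auto simp: inj_on_def V_def doubleton_eq_iff)
  have disj: "Ai \<inter> Aj = {}"
    using ij by (auto simp: Ai_def Aj_def V_def doubleton_eq_iff)
  have sub: "Ai \<union> Aj \<subseteq> vertex_pairs n"
    using ij by (auto simp: Ai_def Aj_def V_def vertex_pairs_def)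
  have "(\<Prod>e\<in>vertex_pairs n. f e) = (\<Prod>e\<in>A0. f e) * (\<Prod>u\<in>V. f {i, u} * f {j, u})" for f :: "nat set \<Rightarrow> real"
  proof -
    have "(\<Prod>e\<in>vertex_pairs n. f e) = (\<Prod>e\<in>A0. f e) * (\<Prod>e\<in>Ai \<union> Aj. f e)"
      unfolding A0_def by (rule prod.subset_diff[OF sub]) simp
    also have "(\<Prod>e\<in>Ai \<union> Aj. f e) = (\<Prod>u\<in>V. f {i, u}) * (\<Prod>u\<in>V. f {j, u})"
      using fin disj by (simp add: prod.union_disjoint) (simp add: Ai_def Aj_def prod.reindex inj)
    finally show ?thesis by (simp add: prod.distrib)
  qed
  moreover have "Transposition.transpose i j ` e = e" if e: "e \<in> A0" for e
  proof -
    have "e \<subseteq> {1..n}" "card e = 2" using e by (auto simp: A0_def vertex_pairs_def)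
    then obtain x y where xy: "e = {x, y}" "x \<noteq> y" "x \<in> {1..n}" "y \<in> {1..n}"
      by (auto simp: card_2_iff)
    have "e = {i, j} \<or> (i \<notin> e \<and> j \<notin> e)"
    proof (rule ccontr)
      assume "\<not> ?thesis"
      then have "(x = i \<and> y \<in> V) \<or> (y = i \<and> x \<in> V) \<or> (x = j \<and> y \<in> V) \<or> (y = j \<and> x \<in> V)"
        using xy by (auto simp: V_def)
      then have "e \<in> Ai \<union> Aj" using xy by (auto simp: Ai_def Aj_def insert_commute)
      then show False using e by (simp add: A0_def)
    qed
    then show ?thesis
    proof
      assume "e = {i, j}" then show ?thesis by (simp add: insert_commute)
    next
      assume "i \<notin> e \<and> j \<notin> e"
      then have "Transposition.transpose i j x = x" if "x \<in> e" for x using that by (metis transpose_apply_other)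
      then show ?thesis by (metis (mono_tags, lifting) image_cong image_ident)
    qed
  qed
  ultimately show ?thesis by (rule that)
qed

text \<open>The couples \<open>{i, u}\<close>, \<open>{j, u}\<close> are compared one by one for
  \<open>u\<close> in \<open>R\<close> by \<open>edge_law_exchange\<close>. Multiplied over
  \<open>R\<close>, the odds weights on both sides become the same power of the two possible odds,
  because all four neighbour counts equal \<open>m\<close>.\<close>

lemma pattern_law_swap:
  assumes pq: "0 < p" "p < 1" "0 < q" "q < 1" and s: "0 \<le> s" "s \<le> 1"
    and SR: "S \<union> R = {1..n}" "S \<inter> R = {}" and ij: "i \<in> S" "j \<in> S" "\<sigma> i \<noteq> \<sigma> j"
    and lab: "\<And>u. u \<in> R \<Longrightarrow> \<sigma> u = \<sigma> i \<or> \<sigma> u = \<sigma> j"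
    and gi: "good T S R m \<sigma> c i" and gj: "good T S R m \<sigma> c j"
  shows "pmf (pattern_law K n p q s \<sigma>) c \<le>
         pmf (pattern_law K n p q s (\<sigma> \<circ> Transposition.transpose i j))
           (\<lambda>e. (c e - T) \<union> (c (Transposition.transpose i j ` e) \<inter> T))"
proof (cases "c \<in> set_pmf (pattern_law K n p q s \<sigma>)")
  case False
  then show ?thesis by (simp add: set_pmf_iff)
next
  case True
  define \<tau> where "\<tau> = Transposition.transpose i j"
  let ?A = "vertex_pairs n"
  define W where "W = edge_weight p q \<sigma>"
  define \<phi> where "\<phi> = (\<lambda>w. pmf (edge_law K s w))"
  have c_out: "c e = {}" if "e \<notin> ?A" for e
    using True that set_Pi_pmf_subset[of ?A "{}"] by (auto simp: pattern_law_def)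
  have c_sub: "c e \<subseteq> {1..K}" for e
  proof (cases "e \<in> ?A")
    case e: True
    then have "c e \<in> set_pmf (edge_law K s (edge_weight p q \<sigma> e))"
      using True by (auto simp: pattern_law_def set_Pi_pmf PiE_dflt_def)
    then show ?thesis using set_pmf_edge_law by blast
  qed (simp add: c_out)
  have ijn: "i \<in> {1..n}" "j \<in> {1..n}" "i \<noteq> j" using SR ij by auto
  have \<tau>A: "\<tau> ` e \<in> ?A \<longleftrightarrow> e \<in> ?A" for e
    using transpose_image_vertex_pairs[OF ijn(1,2), of e]
      transpose_image_vertex_pairs[OF ijn(1,2), of "\<tau> ` e"] by (auto simp: \<tau>_def)
  define c' where "c' = (\<lambda>e. (c e - T) \<union> (c (\<tau> ` e) \<inter> T))"
  \<comment> \<open>Reindexing the product by \<open>\<tau>\<close> restores the original edge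
    weights. Seen this way, the exchange leaves the labels alone and moves the parts of the patterns
    outside \<open>T\<close> instead of those inside.\<close>
  define d where "d = (\<lambda>e. (c (\<tau> ` e) - T) \<union> (c e \<inter> T))"
  have c'_out: "c' e = {}" if "e \<notin> ?A" for e
    using that \<tau>A[of e] by (simp add: c'_def c_out)
  have W': "edge_weight p q (\<sigma> \<circ> \<tau>) e = W (\<tau> ` e)" for e
    by (simp add: W_def edge_weight_def)
  have L: "pmf (pattern_law K n p q s \<sigma>) c = (\<Prod>e\<in>?A. \<phi> (W e) (c e))"
    using c_out by (simp add: pattern_law_def pmf_Pi' \<phi>_def W_def)
  have "pmf (pattern_law K n p q s (\<sigma> \<circ> \<tau>)) c' = (\<Prod>e\<in>?A. \<phi> (W (\<tau> ` e)) (c' e))"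
    using c'_out by (simp add: pattern_law_def pmf_Pi' \<phi>_def W')
  also have "\<dots> = (\<Prod>e\<in>?A. \<phi> (W e) (d e))"
    by (rule prod.reindex_bij_witness[of _ "\<lambda>e. \<tau> ` e" "\<lambda>e. \<tau> ` e"])
       (simp_all add: \<tau>A, simp_all add: \<tau>_def c'_def d_def)
  finally have R: "pmf (pattern_law K n p q s (\<sigma> \<circ> \<tau>)) c' = (\<Prod>e\<in>?A. \<phi> (W e) (d e))" .
  define V where "V = {1..n} - {i, j}"
  obtain A0 where split: "\<And>f. (\<Prod>e\<in>?A. f e :: real) = (\<Prod>e\<in>A0. f e) * (\<Prod>u\<in>V. f {i, u} * f {j, u})"
    and A0: "\<And>e. e \<in> A0 \<Longrightarrow> \<tau> ` e = e"
    by (rule prod_vertex_pairs_split[OF ijn, folded V_def \<tau>_def]) blast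
  have dA0: "d e = c e" if "e \<in> A0" for e using A0[OF that] by (auto simp: d_def)
  have \<tau>iu: "\<tau> ` {i, u} = {j, u}" "\<tau> ` {j, u} = {i, u}" if "u \<in> V" for u
    using that by (auto simp: \<tau>_def V_def Transposition.transpose_def)
  have VSR: "V = (S - {i, j}) \<union> R" "(S - {i, j}) \<inter> R = {}"
    using SR ij by (auto simp: V_def)
  have fin: "finite S" "finite R" using SR by (metis finite_Un finite_atLeastAtMost)+
  \<comment> \<open>Inside \<open>S\<close> the patterns at \<open>i\<close> and \<open>j\<close>
    have no part outside \<open>T\<close>, so there is nothing to move.\<close>
  have S: "d {i, u} = c {i, u}" "d {j, u} = c {j, u}" if "u \<in> S - {i, j}" for u
  proof -
    have "c {i, u} \<subseteq> T" "c {j, u} \<subseteq> T" using gi gj that by (auto simp: good_def)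
    moreover have "u \<in> V" using that VSR by blast
    ultimately show "d {i, u} = c {i, u}" "d {j, u} = c {j, u}"
      using \<tau>iu[of u] unfolding d_def by auto
  qed
  define F where "F = (\<lambda>b u. \<phi> (W {i, u}) (b {i, u}) * \<phi> (W {j, u}) (b {j, u}))"
  define \<kappa> where "\<kappa> = (\<lambda>w Z. if \<not> Z \<subseteq> T then w / \<phi> w {} else 1)"
  have \<phi>pos: "\<phi> w {} > 0" if "0 < w" "w < 1" for w
    using that s by (auto simp: \<phi>_def pmf_edge_law intro!: add_pos_nonneg)
  have Wpq: "0 < W e" "W e < 1" for e using pq by (auto simp: W_def edge_weight_def)
  have \<kappa>pos: "\<kappa> w Z > 0" if "0 < w" "w < 1" for w Z using that \<phi>pos by (auto simp: \<kappa>_def)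
  have ex: "F c u * (\<kappa> (W {j, u}) (c {i, u}) * \<kappa> (W {i, u}) (c {j, u})) \<le>
            F d u * (\<kappa> (W {i, u}) (c {i, u}) * \<kappa> (W {j, u}) (c {j, u}))" if "u \<in> R" for u
  proof -
    have "c {i, u} \<subseteq> T \<or> c {i, u} \<inter> T = {}" "c {j, u} \<subseteq> T \<or> c {j, u} \<inter> T = {}"
      using gi gj that by (auto simp: good_def)
    note X = this
    have "u \<in> V" using that VSR by blast
    note \<tau> = \<tau>iu[OF this]
    show ?thesis
      unfolding F_def d_def \<kappa>_def \<phi>_def \<tau>
      by (rule edge_law_exchange[OF Wpq Wpq s c_sub X(1) c_sub X(2)])
  qed
  have Wi: "W {i, u} = (if \<sigma> u = \<sigma> i then p else q)" "W {j, u} = (if \<sigma> u = \<sigma> i then q else p)"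
    if "u \<in> R" for u
  proof -
    have "W {i, u} = (if \<sigma> i = \<sigma> u then p else q)" "W {j, u} = (if \<sigma> j = \<sigma> u then p else q)"
      by (auto simp: W_def edge_weight_def)
    then show "W {i, u} = (if \<sigma> u = \<sigma> i then p else q)" "W {j, u} = (if \<sigma> u = \<sigma> i then q else p)"
      using lab[OF that] ij(3) by (metis (full_types))+
  qed
  define P where "P = p / \<phi> p {}"
  define Q where "Q = q / \<phi> q {}"
  have card: "card {u \<in> R. \<sigma> u = \<sigma> i \<and> \<not> c {i, u} \<subseteq> T} = m"
    "card {u \<in> R. \<sigma> u \<noteq> \<sigma> i \<and> \<not> c {i, u} \<subseteq> T} = m"
    "card {u \<in> R. \<sigma> u = \<sigma> i \<and> \<not> c {j, u} \<subseteq> T} = m"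
    "card {u \<in> R. \<sigma> u \<noteq> \<sigma> i \<and> \<not> c {j, u} \<subseteq> T} = m"
  proof -
    \<comment> \<open>Goodness of \<open>j\<close> counts neighbours relative to the label of
      \<open>j\<close>; only two labels occur on \<open>R\<close>, so its two counts trade places
      when expressed by the label of \<open>i\<close>.\<close>
    have "{u \<in> R. \<sigma> u = \<sigma> i \<and> \<not> c {j, u} \<subseteq> T} = {u \<in> R. \<sigma> u \<noteq> \<sigma> j \<and> \<not> c {j, u} \<subseteq> T}"
      "{u \<in> R. \<sigma> u \<noteq> \<sigma> i \<and> \<not> c {j, u} \<subseteq> T} = {u \<in> R. \<sigma> u = \<sigma> j \<and> \<not> c {j, u} \<subseteq> T}"
      using lab ij by metis+
    then show "card {u \<in> R. \<sigma> u = \<sigma> i \<and> \<not> c {i, u} \<subseteq> T} = m"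
      "card {u \<in> R. \<sigma> u \<noteq> \<sigma> i \<and> \<not> c {i, u} \<subseteq> T} = m"
      "card {u \<in> R. \<sigma> u = \<sigma> i \<and> \<not> c {j, u} \<subseteq> T} = m"
      "card {u \<in> R. \<sigma> u \<noteq> \<sigma> i \<and> \<not> c {j, u} \<subseteq> T} = m"
      using gi gj by (simp_all add: good_def)
  qed
  have prod\<kappa>: "(\<Prod>u\<in>R. \<kappa> (W {i, u}) (c {l, u})) = P ^ m * Q ^ m"
    "(\<Prod>u\<in>R. \<kappa> (W {j, u}) (c {l, u})) = Q ^ m * P ^ m" if "l \<in> {i, j}" for l
  proof -
    have "(\<Prod>u\<in>R. \<kappa> (W {i, u}) (c {l, u})) =
          (\<Prod>u\<in>R. if \<not> c {l, u} \<subseteq> T then (if \<sigma> u = \<sigma> i then P else Q) else 1)"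
      by (intro prod.cong) (auto simp: \<kappa>_def P_def Q_def Wi)
    then show "(\<Prod>u\<in>R. \<kappa> (W {i, u}) (c {l, u})) = P ^ m * Q ^ m"
      unfolding prod_if_power[OF fin(2)] using that card by auto
    have "(\<Prod>u\<in>R. \<kappa> (W {j, u}) (c {l, u})) =
          (\<Prod>u\<in>R. if \<not> c {l, u} \<subseteq> T then (if \<sigma> u = \<sigma> i then Q else P) else 1)"
      by (intro prod.cong) (auto simp: \<kappa>_def P_def Q_def Wi)
    then show "(\<Prod>u\<in>R. \<kappa> (W {j, u}) (c {l, u})) = Q ^ m * P ^ m"
      unfolding prod_if_power[OF fin(2)] using that card by auto
  qed
  have F0: "F b u \<ge> 0" for b u by (simp add: F_def \<phi>_def)
  have "(\<Prod>u\<in>R. F c u) * ((Q ^ m * P ^ m) * (P ^ m * Q ^ m)) \<le>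
        (\<Prod>u\<in>R. F d u) * ((P ^ m * Q ^ m) * (Q ^ m * P ^ m))"
  proof -
    have "(\<Prod>u\<in>R. F c u * (\<kappa> (W {j, u}) (c {i, u}) * \<kappa> (W {i, u}) (c {j, u}))) \<le>
          (\<Prod>u\<in>R. F d u * (\<kappa> (W {i, u}) (c {i, u}) * \<kappa> (W {j, u}) (c {j, u})))"
      using ex F0 Wpq \<kappa>pos by (intro prod_mono conjI mult_nonneg_nonneg) (auto simp: less_imp_le)
    then show ?thesis by (simp only: prod.distrib prod\<kappa> insertI1 insertI2)
  qed
  moreover have "P > 0" "Q > 0" using pq \<phi>pos by (auto simp: P_def Q_def)
  ultimately have RR: "(\<Prod>u\<in>R. F c u) \<le> (\<Prod>u\<in>R. F d u)"
    by (simp add: mult_ac)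
  have "(\<Prod>u\<in>V. F c u) \<le> (\<Prod>u\<in>V. F d u)"
  proof -
    have "(\<Prod>u\<in>V. F b u) = (\<Prod>u\<in>S-{i,j}. F b u) * (\<Prod>u\<in>R. F b u)" for b
      unfolding VSR(1) using VSR(2) fin by (intro prod.union_disjoint) auto
    moreover have "(\<Prod>u\<in>S-{i,j}. F c u) = (\<Prod>u\<in>S-{i,j}. F d u)"
      by (intro prod.cong) (auto simp: F_def S)
    ultimately show ?thesis using RR F0 by (auto intro!: mult_left_mono prod_nonneg)
  qed
  moreover have "(\<Prod>e\<in>A0. \<phi> (W e) (c e)) = (\<Prod>e\<in>A0. \<phi> (W e) (d e))"
    by (intro prod.cong) (simp_all add: dA0)
  moreover have "(\<Prod>e\<in>A0. \<phi> (W e) (d e)) \<ge> 0" by (intro prod_nonneg) (simp add: \<phi>_def)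
  ultimately have "pmf (pattern_law K n p q s \<sigma>) c \<le> pmf (pattern_law K n p q s (\<sigma> \<circ> \<tau>)) c'"
    unfolding L R split F_def by (simp add: mult_left_mono)
  then show ?thesis by (simp add: c'_def \<tau>_def)
qed

subsection \<open>Success probability and the number of exchangeable pairs\<close>

text \<open>Double counting: each configuration in \<open>E\<close> gives its mass to at least
  \<open>M\<close> configurations that are no less likely, and no configuration is reached twice.
  Hence \<open>M\<close> times the mass of \<open>E\<close> fits into the total mass 1.\<close>

lemma mult_prob_le_1_of_dominating_moves:
  fixes D :: "'a pmf"
  assumes fin: "finite (set_pmf D)" "\<And>w. w \<in> E \<Longrightarrow> finite (I w)"
    and card: "\<And>w. w \<in> E \<Longrightarrow> M \<le> card (I w)"
    and le: "\<And>w t. w \<in> E \<Longrightarrow> t \<in> I w \<Longrightarrow> pmf D w \<le> pmf D (f t w)"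
    and inj: "\<And>w w' t t'. w \<in> E \<Longrightarrow> w' \<in> E \<Longrightarrow> t \<in> I w \<Longrightarrow> t' \<in> I w' \<Longrightarrow> f t w = f t' w' \<Longrightarrow> w = w' \<and> t = t'"
  shows "real M * measure_pmf.prob D E \<le> 1"
proof -
  define E' where "E' = E \<inter> set_pmf D"
  have E': "finite E'" "E' \<subseteq> E" using fin by (auto simp: E'_def)
  have finI: "\<And>w. w \<in> E' \<Longrightarrow> finite (I w)" using fin E' by blast
  have "real M * measure_pmf.prob D E = real M * measure_pmf.prob D E'"
    by (simp add: E'_def measure_Int_set_pmf)
  also have "\<dots> = (\<Sum>w\<in>E'. real M * pmf D w)"
    using E' by (simp add: measure_measure_pmf_finite sum_distrib_left)
  also have "\<dots> \<le> (\<Sum>w\<in>E'. \<Sum>t\<in>I w. pmf D (f t w))"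
  proof (rule sum_mono)
    fix w assume w: "w \<in> E'"
    then have wE: "w \<in> E" using E' by blast
    have "real M * pmf D w \<le> real (card (I w)) * pmf D w"
      using card[OF wE] by (intro mult_right_mono) auto
    also have "\<dots> = (\<Sum>t\<in>I w. pmf D w)" by simp
    also have "\<dots> \<le> (\<Sum>t\<in>I w. pmf D (f t w))" using le[OF wE] by (rule sum_mono)
    finally show "real M * pmf D w \<le> (\<Sum>t\<in>I w. pmf D (f t w))" .
  qed
  also have "\<dots> = (\<Sum>(w, t)\<in>Sigma E' I. pmf D (f t w))"
    using E' finI by (simp add: sum.Sigma)
  also have "\<dots> = sum (pmf D) ((\<lambda>(w, t). f t w) ` Sigma E' I)"
  proof (subst sum.reindex)
    show "inj_on (\<lambda>(w, t). f t w) (Sigma E' I)"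
      using inj E'(2) by (auto simp: inj_on_def) blast+
  qed (auto intro!: sum.cong)
  also have "\<dots> = measure_pmf.prob D ((\<lambda>(w, t). f t w) ` Sigma E' I)"
    using E' finI by (simp add: measure_measure_pmf_finite)
  also have "\<dots> \<le> 1" by simp
  finally show ?thesis .
qed

section \<open>Invariance of the observation and of the priors under an exchange\<close>

lemma swap_swap: "swap T i j (swap T i j w) = w"
proof (cases w)
  case (fields \<sigma> c \<pi>)
  have "(\<lambda>e. ((c e - T) \<union> (c (Transposition.transpose i j ` e) \<inter> T) - T) \<union>
         (((c (Transposition.transpose i j ` e) - T) \<union> (c e \<inter> T)) \<inter> T)) = c"
    by (auto simp: fun_eq_iff)
  then show ?thesis by (simp add: fields comp_assoc fun_eq_iff)
qed

text \<open>In a layer of \<open>T\<close> the pattern is transported by the transposition and the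
  permutation is precomposed with it, so the two effects cancel. The other layers are
  untouched.\<close>

lemma observed_swap:
  assumes "i \<in> {1..n}" "j \<in> {1..n}" "T \<subseteq> {2..K}" and eq: "swap T i j (\<sigma>, c, \<pi>) = (\<sigma>', c', \<pi>')"
  shows "observed K n c' \<pi>' = observed K n c \<pi>"
proof
  fix k
  let ?\<tau> = "Transposition.transpose i j"
  have \<tau>A: "?\<tau> ` e \<in> vertex_pairs n \<longleftrightarrow> e \<in> vertex_pairs n" for e
    using transpose_image_vertex_pairs[OF assms(1,2), of e]
      transpose_image_vertex_pairs[OF assms(1,2), of "?\<tau> ` e"] by auto
  have c': "c' = (\<lambda>e. (c e - T) \<union> (c (?\<tau> ` e) \<inter> T))"
    and \<pi>': "\<pi>' = (\<lambda>k. if k \<in> T then \<pi> k \<circ> ?\<tau> else \<pi> k)" using eq by auto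
  show "observed K n c' \<pi>' k = observed K n c \<pi> k"
  proof (cases "k \<in> T")
    case False
    then show ?thesis by (simp add: observed_def layer_def c' \<pi>')
  next
    case True
    have "layer n c' k = {e \<in> vertex_pairs n. k \<in> c (?\<tau> ` e)}"
      using True by (auto simp: layer_def c')
    also have "\<dots> = (\<lambda>e. ?\<tau> ` e) ` layer n c k"
    proof (intro equalityI subsetI)
      fix e assume e: "e \<in> {e \<in> vertex_pairs n. k \<in> c (?\<tau> ` e)}"
      then have "?\<tau> ` e \<in> layer n c k" using \<tau>A[of e] by (simp add: layer_def)
      moreover have "e = ?\<tau> ` ?\<tau> ` e" by (rule transpose_image_image[symmetric])
      ultimately show "e \<in> (\<lambda>e. ?\<tau> ` e) ` layer n c k" by (rule rev_image_eqI)
    qed (auto simp only: layer_def mem_Collect_eq \<tau>A transpose_image_image)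
    finally have L: "layer n c' k = (\<lambda>e. ?\<tau> ` e) ` layer n c k" .
    have "(\<pi> k \<circ> ?\<tau>) ` ?\<tau> ` e = \<pi> k ` e" for e
      by (simp add: image_comp comp_assoc)
    then have "relabel (\<pi> k \<circ> ?\<tau>) ((\<lambda>e. ?\<tau> ` e) ` G) = relabel (\<pi> k) G" for G
      unfolding relabel_def image_image[of _ "(`) ?\<tau>"] by (simp only:)
    then show ?thesis using True assms(3) by (auto simp: observed_def L \<pi>')
  qed
qed

lemma pmf_uniform_labels_transpose:
  assumes "i \<in> {1..n}" "j \<in> {1..n}"
  shows "pmf (uniform_labels n) (\<sigma> \<circ> Transposition.transpose i j) = pmf (uniform_labels n) \<sigma>"
proof -
  let ?\<tau> = "Transposition.transpose i j"
  have \<tau>: "?\<tau> x \<in> {1..n} \<longleftrightarrow> x \<in> {1..n}" for x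
    using assms unfolding Transposition.transpose_def by auto
  have "(\<forall>x. x \<notin> {1..n} \<longrightarrow> (\<sigma> \<circ> ?\<tau>) x = 0) \<longleftrightarrow> (\<forall>x. x \<notin> {1..n} \<longrightarrow> \<sigma> x = 0)"
    using \<tau> by (metis comp_apply transpose_involutory)
  moreover have "(\<Prod>x\<in>{1..n}. pmf (pmf_of_set {1, -1}) ((\<sigma> \<circ> ?\<tau>) x)) =
                 (\<Prod>x\<in>{1..n}. pmf (pmf_of_set {1, -1 :: int}) (\<sigma> x))"
    by (rule prod.reindex_bij_witness[of _ ?\<tau> ?\<tau>]) (use \<tau> in auto)
  ultimately show ?thesis
    unfolding uniform_labels_def pmf_Pi[OF finite_atLeastAtMost] by (simp only:)
qed

text \<open>Composition with a transposition preserves the uniform law on permutations;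
  \<open>T \<subseteq> {2..K}\<close> ensures that the default \<open>id\<close> at all other
  indices is not altered.\<close>

lemma pmf_perm_law_transpose:
  assumes "i \<in> {1..n}" "j \<in> {1..n}" and T: "T \<subseteq> {2..K}"
  shows "pmf (perm_law K n) (\<lambda>k. if k \<in> T then \<pi> k \<circ> Transposition.transpose i j else \<pi> k) =
         pmf (perm_law K n) \<pi>"
proof -
  let ?\<tau> = "Transposition.transpose i j" and ?P = "{\<pi>. \<pi> permutes {1..n}}"
  have "\<rho> \<circ> ?\<tau> permutes {1..n} \<longleftrightarrow> \<rho> permutes {1..n}" for \<rho> :: "nat \<Rightarrow> nat"
  proof
    assume *: "\<rho> \<circ> ?\<tau> permutes {1..n}"
    have "(\<rho> \<circ> ?\<tau>) \<circ> ?\<tau> permutes {1..n}"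
      by (rule permutes_compose[OF permutes_swap_id[OF assms(1,2)] *])
    then show "\<rho> permutes {1..n}" by (simp add: comp_assoc)
  qed (use assms in \<open>intro permutes_compose permutes_swap_id\<close>)
  moreover have "?P \<noteq> {}" "finite ?P" using permutes_id[of "{1..n}"] by (blast, simp add: finite_permutations)
  ultimately have "pmf (pmf_of_set ?P) (\<rho> \<circ> ?\<tau>) = pmf (pmf_of_set ?P) \<rho>" for \<rho>
    by (simp add: indicator_def)
  moreover have "(\<forall>x. x \<notin> {2..K} \<longrightarrow> (if x \<in> T then \<pi> x \<circ> ?\<tau> else \<pi> x) = id) \<longleftrightarrow>
        (\<forall>x. x \<notin> {2..K} \<longrightarrow> \<pi> x = id)" using T by (metis subsetD)
  ultimately show ?thesis
    unfolding perm_law_def pmf_Pi[OF finite_atLeastAtMost]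
    by (auto intro!: prod.cong)
qed

text \<open>The pairs are ordered by label, so each exchange is listed only once; this is what makes
  exchanges from different pairs distinguishable.\<close>

definition good_pairs :: "nat set \<Rightarrow> nat set \<Rightarrow> nat set \<Rightarrow> nat \<Rightarrow> (nat \<Rightarrow> int) \<Rightarrow> (nat set \<Rightarrow> nat set) \<Rightarrow> (nat \<times> nat) set" where
  "good_pairs T S R m \<sigma> c =
     {(i, j). i \<in> S \<and> j \<in> S \<and> \<sigma> i = 1 \<and> \<sigma> j = -1 \<and> good T S R m \<sigma> c i \<and> good T S R m \<sigma> c j}"

lemma labels_in_support:
  assumes "\<sigma> \<in> set_pmf (uniform_labels n)"
  shows "u \<in> {1..n} \<Longrightarrow> \<sigma> u \<in> {1, -1}"
  using assms unfolding uniform_labels_def set_Pi_pmf[OF finite_atLeastAtMost]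
  by (auto simp: PiE_dflt_def)

lemma pmf_latent_swap:
  assumes pq: "0 < p" "p < 1" "0 < q" "q < 1" and s: "0 \<le> s" "s \<le> 1"
    and T: "T \<subseteq> {2..K}" and SR: "S \<union> R = {1..n}" "S \<inter> R = {}"
    and ij: "(i, j) \<in> good_pairs T S R m \<sigma> c"
  shows "pmf (latent K n p q s) (\<sigma>, c, \<pi>) \<le> pmf (latent K n p q s) (swap T i j (\<sigma>, c, \<pi>))"
proof (cases "\<sigma> \<in> set_pmf (uniform_labels n)")
  case False
  then show ?thesis by (simp add: pmf_latent set_pmf_iff)
next
  case True
  have ij': "i \<in> S" "j \<in> S" "\<sigma> i = 1" "\<sigma> j = -1" "good T S R m \<sigma> c i" "good T S R m \<sigma> c j"
    using ij by (auto simp: good_pairs_def)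
  have n: "i \<in> {1..n}" "j \<in> {1..n}" using ij' SR by auto
  have "pmf (pattern_law K n p q s \<sigma>) c \<le>
         pmf (pattern_law K n p q s (\<sigma> \<circ> Transposition.transpose i j))
           (\<lambda>e. (c e - T) \<union> (c (Transposition.transpose i j ` e) \<inter> T))"
  proof (rule pattern_law_swap[OF pq s SR ij'(1,2) _ _ ij'(5,6)])
    show "\<sigma> i \<noteq> \<sigma> j" using ij' by simp
    show "\<sigma> u = \<sigma> i \<or> \<sigma> u = \<sigma> j" if "u \<in> R" for u
      using labels_in_support[OF True, of u] SR that ij' by auto
  qed
  then show ?thesis
    by (simp add: pmf_latent pmf_uniform_labels_transpose[OF n] pmf_perm_law_transpose[OF n T]
        mult_left_mono mult_right_mono)
qed

lemma finite_set_pmf_latent: "finite (set_pmf (latent K n p q s))"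
proof -
  have "finite (set_pmf (uniform_labels n))"
    unfolding uniform_labels_def by (auto simp: set_Pi_pmf)
  moreover have "finite (set_pmf (perm_law K n))"
  proof -
    have "{\<pi>. \<pi> permutes {1..n}} \<noteq> {}" "finite {\<pi>. \<pi> permutes {1..n}}"
      using permutes_id[of "{1..n}"] by (blast, simp add: finite_permutations)
    then show ?thesis
      unfolding perm_law_def by (auto simp: set_Pi_pmf intro!: finite_PiE_dflt)
  qed
  moreover have "finite (set_pmf (pattern_law K n p q s \<sigma>))" for \<sigma>
    unfolding pattern_law_def
    using finite_subset[OF set_pmf_edge_law finite_Pow_iff[THEN iffD2, OF finite_atLeastAtMost]]
    by (auto simp: set_Pi_pmf)
  ultimately show ?thesis by (auto simp: latent_def)
qed

text \<open>This is the equality case of the triangle inequality: a sum of \<open>n\<close> signs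
  has absolute value \<open>n\<close> only if all signs agree.\<close>

lemma ov_eq_1_imp:
  assumes "n > 0" and \<sigma>: "\<And>i. i \<in> {1..n} \<Longrightarrow> \<sigma> i \<in> {1, -1}" and \<sigma>': "\<And>i. i \<in> {1..n} \<Longrightarrow> \<sigma>' i \<in> {1, -1}"
    and ov: "ov n \<sigma> \<sigma>' = 1"
  shows "\<exists>\<epsilon>\<in>{1, -1}. \<forall>i\<in>{1..n}. \<sigma>' i = \<epsilon> * \<sigma> i"
proof -
  define x where "x = (\<lambda>i. real_of_int (\<sigma> i * \<sigma>' i))"
  have x: "x i \<in> {1, -1}" if "i \<in> {1..n}" for i using \<sigma>[OF that] \<sigma>'[OF that] by (auto simp: x_def)
  have "\<bar>\<Sum>i=1..n. x i\<bar> = real n" using ov \<open>n > 0\<close> by (simp add: ov_def x_def)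
  then consider "(\<Sum>i=1..n. 1 - x i) = 0" | "(\<Sum>i=1..n. 1 + x i) = 0"
    by (auto simp: sum.distrib sum_subtractf abs_if split: if_splits)
  then have "(\<forall>i\<in>{1..n}. x i = 1) \<or> (\<forall>i\<in>{1..n}. x i = -1)"
  proof cases
    case 1
    then have "\<forall>i\<in>{1..n}. 1 - x i = 0" using x by (subst (asm) sum_nonneg_eq_0_iff) force+
    then show ?thesis by auto
  next
    case 2
    then have "\<forall>i\<in>{1..n}. 1 + x i = 0" using x by (subst (asm) sum_nonneg_eq_0_iff) force+
    then show ?thesis by auto
  qed
  then show ?thesis
  proof
    assume a: "\<forall>i\<in>{1..n}. x i = 1"
    have "\<sigma>' i = 1 * \<sigma> i" if "i \<in> {1..n}" for i
      using \<sigma>[OF that] \<sigma>'[OF that] bspec[OF a that] by (auto simp: x_def)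
    then show ?thesis by blast
  next
    assume a: "\<forall>i\<in>{1..n}. x i = -1"
    have "\<sigma>' i = -1 * \<sigma> i" if "i \<in> {1..n}" for i
      using \<sigma>[OF that] \<sigma>'[OF that] bspec[OF a that] by (auto simp: x_def)
    then show ?thesis by blast
  qed
qed

text \<open>An exchange flips the labels of exactly its two vertices, and the sign before the flip
  tells which one comes first. The pair can therefore be read off from the labellings before and
  after.\<close>

lemma good_pairs_identifiable:
  assumes SR: "S \<union> R = {1..n}"
    and t: "(i, j) \<in> good_pairs T S R m \<sigma> c" "(i', j') \<in> good_pairs T S R m \<sigma>' c'"
    and eq: "\<And>u. u \<in> {1..n} \<Longrightarrow> \<sigma> u = \<sigma>' u"
    and swap: "\<sigma> \<circ> Transposition.transpose i j = \<sigma>' \<circ> Transposition.transpose i' j'"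
  shows "i = i' \<and> j = j'"
proof -
  let ?\<tau> = "Transposition.transpose i j" and ?\<tau>' = "Transposition.transpose i' j'"
  have ij: "i \<in> {1..n}" "j \<in> {1..n}" "\<sigma> i = 1" "\<sigma> j = -1"
    and ij': "i' \<in> {1..n}" "j' \<in> {1..n}" "\<sigma>' i' = 1" "\<sigma>' j' = -1"
    using t SR by (auto simp: good_pairs_def)
  have s: "\<sigma> (?\<tau> x) = \<sigma>' (?\<tau>' x)" for x using swap by (metis comp_apply)
  have "i = i'"
  proof (rule ccontr)
    assume "i \<noteq> i'"
    moreover have "i \<noteq> j'" using ij ij' eq[of i] by auto
    ultimately have "\<sigma>' (?\<tau>' i) = \<sigma>' i" by simp
    then show False using s[of i] ij eq[of i] by simp
  qed
  moreover have "j = j'"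
  proof (rule ccontr)
    assume "j \<noteq> j'"
    moreover have "j \<noteq> i'" using ij ij' eq[of j] by auto
    ultimately have "\<sigma>' (?\<tau>' j) = \<sigma>' j" by simp
    then show False using s[of j] ij eq[of j] by simp
  qed
  ultimately show ?thesis by simp
qed

text \<open>On the event considered, the labels are a function of the observation, and an exchange
  does not change the observation. So the result of an exchange reveals the original labels, hence
  the pair, and undoing the exchange gives back the whole configuration. This is the injectivity
  required for the double counting.\<close>

lemma prob_recovery_signed:
  fixes est :: "(nat \<Rightarrow> graph) \<Rightarrow> nat \<Rightarrow> int"
  assumes pq: "0 < p" "p < 1" "0 < q" "q < 1" and s: "0 \<le> s" "s \<le> 1"
    and T: "T \<subseteq> {2..K}" and SR: "S \<union> R = {1..n}" "S \<inter> R = {}"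
  shows "real M * measure_pmf.prob (latent K n p q s)
           {(\<sigma>, c, \<pi>). M \<le> card (good_pairs T S R m \<sigma> c) \<and>
              (\<forall>i\<in>{1..n}. \<sigma> i = \<epsilon> * est (observed K n c \<pi>) i)} \<le> 1"
proof (rule mult_prob_le_1_of_dominating_moves[where I = "\<lambda>(\<sigma>, c, \<pi>). good_pairs T S R m \<sigma> c"
          and f = "\<lambda>(i, j) w. swap T i j w"])
  show "finite (set_pmf (latent K n p q s))" by (rule finite_set_pmf_latent)
  have "finite S" using SR by (metis finite_Un finite_atLeastAtMost)
  then have "finite (S \<times> S)" by simp
  then have fin: "finite (good_pairs T S R m \<sigma> c)" for \<sigma> c
    by (rule rev_finite_subset) (auto simp: good_pairs_def)
  let ?E = "{(\<sigma>, c, \<pi>). M \<le> card (good_pairs T S R m \<sigma> c) \<and>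
              (\<forall>i\<in>{1..n}. \<sigma> i = \<epsilon> * est (observed K n c \<pi>) i)}"
  let ?I = "\<lambda>(\<sigma>, c, \<pi>). good_pairs T S R m \<sigma> c"
  show "finite (?I w)" for w by (cases w) (simp add: fin)
  show "w \<in> ?E \<Longrightarrow> M \<le> card (?I w)" for w by auto
  show "pmf (latent K n p q s) w \<le> pmf (latent K n p q s) ((\<lambda>(i, j) w. swap T i j w) t w)"
    if "t \<in> ?I w" for t w
    using that pmf_latent_swap[OF pq s T SR] by (cases t; cases w) auto
  fix w w' t t' assume w: "w \<in> ?E" "w' \<in> ?E" and t: "t \<in> ?I w" "t' \<in> ?I w'"
    and eq: "(\<lambda>(i, j) w. swap T i j w) t w = (\<lambda>(i, j) w. swap T i j w) t' w'"
  obtain \<sigma> c \<pi> where w1: "w = (\<sigma>, c, \<pi>)" by (cases w)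
  obtain \<sigma>' c' \<pi>' where w2: "w' = (\<sigma>', c', \<pi>')" by (cases w')
  obtain i j where t1: "t = (i, j)" by (cases t)
  obtain i' j' where t2: "t' = (i', j')" by (cases t')
  have sw: "swap T i j (\<sigma>, c, \<pi>) = swap T i' j' (\<sigma>', c', \<pi>')" using eq by (simp only: w1 w2 t1 t2 prod.case)
  have ij: "(i, j) \<in> good_pairs T S R m \<sigma> c" "(i', j') \<in> good_pairs T S R m \<sigma>' c'"
    using t by (auto simp: w1 w2 t1 t2)
  then have n: "i \<in> {1..n}" "j \<in> {1..n}" "i' \<in> {1..n}" "j' \<in> {1..n}"
    using SR by (auto simp: good_pairs_def)
  obtain \<sigma>2 c2 \<pi>2 where sw2: "swap T i j (\<sigma>, c, \<pi>) = (\<sigma>2, c2, \<pi>2)" using prod_cases3 by blast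
  have "observed K n c2 \<pi>2 = observed K n c \<pi>" "observed K n c2 \<pi>2 = observed K n c' \<pi>'"
    using observed_swap[OF n(1,2) T sw2] observed_swap[OF n(3,4) T sw2[unfolded sw]] by auto
  then have "\<sigma> u = \<sigma>' u" if "u \<in> {1..n}" for u
    using w that unfolding w1 w2 by auto
  moreover have "\<sigma> \<circ> Transposition.transpose i j = \<sigma>' \<circ> Transposition.transpose i' j'"
    using sw by simp
  ultimately have "i = i' \<and> j = j'"
    by (rule good_pairs_identifiable[OF SR(1) ij])
  then show "w = w' \<and> t = t'" using sw swap_swap[of T i j] w1 w2 t1 t2 by metis
qed

text \<open>Overlap 1 allows a global sign. Each of the two signs contributes at most
  \<open>1 / M\<close>, and configurations with fewer than \<open>M\<close> good pairs are paid for
  separately.\<close>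

lemma prob_recovery_le:
  fixes est :: "(nat \<Rightarrow> graph) \<Rightarrow> nat \<Rightarrow> int"
  assumes pq: "0 < p" "p < 1" "0 < q" "q < 1" and s: "0 \<le> s" "s \<le> 1"
    and T: "T \<subseteq> {2..K}" and SR: "S \<union> R = {1..n}" "S \<inter> R = {}" and "n > 0" "M > 0"
    and est: "\<And>G i. i \<in> {1..n} \<Longrightarrow> est G i \<in> {1, -1}"
  shows "measure_pmf.prob (CSBM K n p q s) {(\<sigma>, G). ov n (est G) \<sigma> = 1} \<le>
         2 / real M + measure_pmf.prob (latent K n p q s)
                        {(\<sigma>, c, \<pi>). card (good_pairs T S R m \<sigma> c) < M}"
proof -
  let ?D = "latent K n p q s"
  define E where "E = (\<lambda>\<epsilon>. {(\<sigma>, c, \<pi>). M \<le> card (good_pairs T S R m \<sigma> c) \<and>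
              (\<forall>i\<in>{1..n}. \<sigma> i = \<epsilon> * est (observed K n c \<pi>) i)})"
  define B where "B = {(\<sigma>, c, \<pi> :: nat \<Rightarrow> nat \<Rightarrow> nat). card (good_pairs T S R m \<sigma> c) < M}"
  define C where "C = {(\<sigma>, c, \<pi>). ov n (est (observed K n c \<pi>)) \<sigma> = 1}"
  have "measure_pmf.prob (CSBM K n p q s) {(\<sigma>, G). ov n (est G) \<sigma> = 1} = measure_pmf.prob ?D C"
    unfolding CSBM_latent measure_map_pmf C_def by (rule arg_cong[where f = "measure ?D"]) auto
  also have "\<dots> = measure_pmf.prob ?D (C \<inter> set_pmf ?D)" by (simp add: measure_Int_set_pmf)
  also have "\<dots> \<le> measure_pmf.prob ?D (E 1 \<union> E (-1) \<union> B)"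
  proof (rule measure_pmf.finite_measure_mono)
    show "C \<inter> set_pmf ?D \<subseteq> E 1 \<union> E (-1) \<union> B"
    proof
      fix w assume w: "w \<in> C \<inter> set_pmf ?D"
      obtain \<sigma> c \<pi> where w1: "w = (\<sigma>, c, \<pi>)" by (cases w)
      have "\<sigma> \<in> set_pmf (uniform_labels n)" using w by (auto simp: w1 latent_def)
      then have "\<exists>\<epsilon>\<in>{1, -1}. \<forall>i\<in>{1..n}. \<sigma> i = \<epsilon> * est (observed K n c \<pi>) i"
        using w by (intro ov_eq_1_imp[OF \<open>n > 0\<close> est labels_in_support]) (auto simp: w1 C_def)
      then show "w \<in> E 1 \<union> E (-1) \<union> B" by (auto simp: w1 E_def B_def)
    qed
  qed simp
  also have "\<dots> \<le> measure_pmf.prob ?D (E 1) + measure_pmf.prob ?D (E (-1)) + measure_pmf.prob ?D B"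
    by (rule order_trans[OF measure_Un_le add_right_mono])
       (auto intro: measure_Un_le)
  also have "\<dots> \<le> 1 / real M + 1 / real M + measure_pmf.prob ?D B"
  proof -
    have "measure_pmf.prob ?D (E \<epsilon>) \<le> 1 / real M" for \<epsilon>
      using prob_recovery_signed[OF pq s T SR, of M m \<epsilon> est] \<open>M > 0\<close>
      unfolding E_def by (simp add: field_simps)
    then show ?thesis by (intro add_mono) auto
  qed
  finally show ?thesis by (simp add: B_def)
qed

subsection \<open>Existence of good vertices\<close>

lemma prob_bind_pmf:
  "measure_pmf.prob (bind_pmf M f) A = (\<integral>x. measure_pmf.prob (f x) A \<partial>measure_pmf M)"
proof -
  \<comment> \<open>A probability is a point mass of the indicator's law, so the formula for point
    masses of a mixture applies.\<close>
  have *: "measure_pmf.prob N A = pmf (map_pmf (\<lambda>x. x \<in> A) N) True" for N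
    by (simp add: pmf_map vimage_def)
  show ?thesis unfolding * map_bind_pmf pmf_bind ..
qed

lemma prob_pair_pmf_Times:
  "measure_pmf.prob (pair_pmf M N) (A \<times> B) = measure_pmf.prob M A * measure_pmf.prob N B"
proof -
  have "measure_pmf.prob (pair_pmf M N) (A \<times> B) =
        measure_pmf.prob (pair_pmf M N) ((A \<inter> set_pmf M) \<times> (B \<inter> set_pmf N))"
    by (rule measure_prob_cong_0) (auto simp: set_pmf_iff pmf_pair)
  also have "\<dots> = measure_pmf.prob M A * measure_pmf.prob N B"
    by (subst measure_pmf_prob_product) (auto simp: measure_Int_set_pmf)
  finally show ?thesis .
qed

text \<open>Takes the place of measurability with respect to a set of coordinates: all events are
  measurable here, so functional dependence is enough for independence.\<close>

definition depends_on :: "(('a \<Rightarrow> 'b) \<Rightarrow> bool) \<Rightarrow> 'a set \<Rightarrow> bool" where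
  "depends_on Q A \<longleftrightarrow> (\<forall>c c'. (\<forall>e\<in>A. c e = c' e) \<longrightarrow> Q c = Q c')"

lemma depends_onD: "depends_on Q A \<Longrightarrow> (\<And>e. e \<in> A \<Longrightarrow> c e = c' e) \<Longrightarrow> Q c = Q c'"
  by (auto simp: depends_on_def)

lemma prob_Pi_pmf_conj:
  assumes fin: "finite A" and sub: "A1 \<subseteq> A" and disj: "A1 \<inter> A2 = {}"
    and Q1: "depends_on Q1 A1" and Q2: "depends_on Q2 A2"
  shows "measure_pmf.prob (Pi_pmf A d P) {c. Q1 c \<and> Q2 c} =
         measure_pmf.prob (Pi_pmf A d P) {c. Q1 c} * measure_pmf.prob (Pi_pmf A d P) {c. Q2 c}"
proof -
  let ?M1 = "Pi_pmf A1 d P" and ?M2 = "Pi_pmf (A - A1) d P"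
  have A: "A = A1 \<union> (A - A1)" using sub by blast
  have "Pi_pmf A d P = map_pmf (\<lambda>(f, g) x. if x \<in> A1 then f x else g x) (pair_pmf ?M1 ?M2)"
    by (subst A, rule Pi_pmf_union) (use fin sub finite_subset in auto)
  then have *: "measure_pmf.prob (Pi_pmf A d P) {c. R1 c \<and> R2 c} =
      measure_pmf.prob ?M1 {c. R1 c} * measure_pmf.prob ?M2 {c. R2 c}"
    if "depends_on R1 A1" "depends_on R2 A2" for R1 R2
  proof -
    have 1: "R1 (\<lambda>x. if x \<in> A1 then f x else g x) = R1 f" for f g
      by (rule depends_onD[OF that(1)]) simp
    have 2: "R2 (\<lambda>x. if x \<in> A1 then f x else g x) = R2 g" for f g
      by (rule depends_onD[OF that(2)]) (use disj in auto)
    have "(\<lambda>(f, g) x. if x \<in> A1 then f x else g x) -` {c. R1 c \<and> R2 c} = {c. R1 c} \<times> {c. R2 c}"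
      using 1 2 by auto
    then show ?thesis
      using \<open>Pi_pmf A d P = _\<close> by (simp add: prob_pair_pmf_Times)
  qed
  have T: "depends_on (\<lambda>_. True) A'" for A' :: "'a set" by (simp add: depends_on_def)
  \<comment> \<open>Taking one event to be always true identifies each factor, computed on part of
    the coordinates, with a probability under the full product.\<close>
  show ?thesis using *[OF Q1 Q2] *[OF Q1 T] *[OF T Q2] by simp
qed

lemma prob_Pi_pmf_Ball:
  fixes Q :: "'i \<Rightarrow> ('a \<Rightarrow> 'b) \<Rightarrow> bool"
  assumes fin: "finite A" "finite I" and sub: "\<And>i. i \<in> I \<Longrightarrow> E i \<subseteq> A"
    and disj: "\<And>i j. i \<in> I \<Longrightarrow> j \<in> I \<Longrightarrow> i \<noteq> j \<Longrightarrow> E i \<inter> E j = {}"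
    and Q: "\<And>i. i \<in> I \<Longrightarrow> depends_on (Q i) (E i)"
  shows "measure_pmf.prob (Pi_pmf A d P) {c. \<forall>i\<in>I. Q i c} =
         (\<Prod>i\<in>I. measure_pmf.prob (Pi_pmf A d P) {c. Q i c})"
  using fin(2) sub disj Q
proof (induction I)
  case (insert x I)
  have "depends_on (\<lambda>c. \<forall>i\<in>I. Q i c) (\<Union>i\<in>I. E i)"
    unfolding depends_on_def
  proof (intro allI impI ball_cong[OF refl])
    fix c c' :: "'a \<Rightarrow> 'b" and i assume "\<forall>e\<in>(\<Union>i\<in>I. E i). c e = c' e" "i \<in> I"
    then show "Q i c = Q i c'" using depends_onD[OF insert.prems(3)[of i]] by blast
  qed
  moreover have "E x \<inter> (\<Union>i\<in>I. E i) = {}" using insert.prems(2)[of x] insert.hyps by blast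
  ultimately have "measure_pmf.prob (Pi_pmf A d P) {c. Q x c \<and> (\<forall>i\<in>I. Q i c)} =
    measure_pmf.prob (Pi_pmf A d P) {c. Q x c} * measure_pmf.prob (Pi_pmf A d P) {c. \<forall>i\<in>I. Q i c}"
    using insert.prems by (intro prob_Pi_pmf_conj[OF fin(1), of "E x"]) auto
  then show ?case using insert by simp
qed simp

text \<open>The bad event is split according to the first \<open>i\<close> satisfying \<open>Q i\<close>, which is independent
  of all the \<open>W j\<close>.\<close>

lemma prob_no_joint_success:
  fixes B :: "'i :: linorder set" and Q :: "'i \<Rightarrow> ('a \<Rightarrow> 'b) \<Rightarrow> bool"
  assumes fin: "finite A" "finite B" and sub: "\<And>i. i \<in> B \<Longrightarrow> E i \<subseteq> A"
    and disj: "\<And>i j. i \<in> B \<Longrightarrow> j \<in> B \<Longrightarrow> i \<noteq> j \<Longrightarrow> E i \<inter> E j = {}"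
    and Q: "\<And>i. i \<in> B \<Longrightarrow> depends_on (Q i) (E i)"
    and W: "\<And>i. i \<in> B \<Longrightarrow> depends_on (W i) F" and F: "\<And>i. i \<in> B \<Longrightarrow> E i \<inter> F = {}"
    and \<delta>: "\<And>i. i \<in> B \<Longrightarrow> measure_pmf.prob (Pi_pmf A d P) {c. \<not> W i c} \<le> \<delta>" and "0 \<le> \<delta>"
  shows "measure_pmf.prob (Pi_pmf A d P) {c. \<forall>i\<in>B. \<not> (W i c \<and> Q i c)} \<le>
         (\<Prod>i\<in>B. 1 - measure_pmf.prob (Pi_pmf A d P) {c. Q i c}) + \<delta>"
proof -
  let ?D = "Pi_pmf A d P"
  \<comment> \<open>\<open>X i\<close> says that \<open>i\<close> is the first index at which
    \<open>Q\<close> holds.\<close>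
  define X where "X = (\<lambda>i c. Q i c \<and> (\<forall>j\<in>{j\<in>B. j < i}. \<not> Q j c))"
  have neg: "depends_on (\<lambda>c. \<not> R c) E'" if "depends_on R E'" for R E'
    using that by (auto simp: depends_on_def)
  have X: "depends_on (X i) (\<Union>j\<in>B. E j)" if "i \<in> B" for i
    unfolding depends_on_def
  proof (intro allI impI)
    fix c c' :: "'a \<Rightarrow> 'b" assume *: "\<forall>e\<in>(\<Union>j\<in>B. E j). c e = c' e"
    have "Q j c = Q j c'" if "j \<in> B" for j
      using depends_onD[OF Q[OF that]] * that by blast
    then show "X i c = X i c'" unfolding X_def using \<open>i \<in> B\<close> by auto
  qed
  have "{c. \<forall>i\<in>B. \<not> (W i c \<and> Q i c)} \<subseteq> {c. \<forall>i\<in>B. \<not> Q i c} \<union> (\<Union>i\<in>B. {c. X i c \<and> \<not> W i c})"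
  proof
    fix c assume c: "c \<in> {c. \<forall>i\<in>B. \<not> (W i c \<and> Q i c)}"
    show "c \<in> {c. \<forall>i\<in>B. \<not> Q i c} \<union> (\<Union>i\<in>B. {c. X i c \<and> \<not> W i c})"
    proof (cases "\<exists>i\<in>B. Q i c")
      case True
      define i where "i = Min {i\<in>B. Q i c}"
      have ne: "finite {i\<in>B. Q i c}" "{i\<in>B. Q i c} \<noteq> {}" using True fin by auto
      then have i: "i \<in> B" "Q i c" using Min_in[OF ne] by (auto simp: i_def)
      have "\<not> Q j c" if "j \<in> B" "j < i" for j
        using Min_le[OF ne(1), of j] that by (auto simp: i_def not_le[symmetric])
      then have "X i c" using i by (auto simp: X_def)
      then show ?thesis using i c by blast
    qed auto
  qed
  then have "measure_pmf.prob ?D {c. \<forall>i\<in>B. \<not> (W i c \<and> Q i c)} \<le>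
      measure_pmf.prob ?D ({c. \<forall>i\<in>B. \<not> Q i c} \<union> (\<Union>i\<in>B. {c. X i c \<and> \<not> W i c}))"
    by (intro measure_pmf.finite_measure_mono) auto
  also have "\<dots> \<le> measure_pmf.prob ?D {c. \<forall>i\<in>B. \<not> Q i c} +
                 measure_pmf.prob ?D (\<Union>i\<in>B. {c. X i c \<and> \<not> W i c})"
    by (rule measure_Un_le) auto
  also have "measure_pmf.prob ?D {c. \<forall>i\<in>B. \<not> Q i c} = (\<Prod>i\<in>B. measure_pmf.prob ?D {c. \<not> Q i c})"
    by (rule prob_Pi_pmf_Ball[OF fin sub disj neg[OF Q]])
  also have "\<dots> = (\<Prod>i\<in>B. 1 - measure_pmf.prob ?D {c. Q i c})"
  proof (rule prod.cong[OF refl])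
    fix i
    have "{c. \<not> Q i c} = space ?D - {c. Q i c}" by auto
    then show "measure_pmf.prob ?D {c. \<not> Q i c} = 1 - measure_pmf.prob ?D {c. Q i c}"
      by (metis measure_pmf.prob_compl sets_measure_pmf UNIV_I Pow_UNIV sets_count_space)
  qed
  also have "measure_pmf.prob ?D (\<Union>i\<in>B. {c. X i c \<and> \<not> W i c}) \<le>
             (\<Sum>i\<in>B. measure_pmf.prob ?D {c. X i c \<and> \<not> W i c})"
    by (rule measure_UNION_le) (use fin in auto)
  also have "\<dots> = (\<Sum>i\<in>B. measure_pmf.prob ?D {c. X i c} * measure_pmf.prob ?D {c. \<not> W i c})"
  proof (rule sum.cong[OF refl])
    fix i assume i: "i \<in> B"
    show "measure_pmf.prob ?D {c. X i c \<and> \<not> W i c} =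
          measure_pmf.prob ?D {c. X i c} * measure_pmf.prob ?D {c. \<not> W i c}"
      by (rule prob_Pi_pmf_conj[OF fin(1) _ _ X[OF i] neg[OF W[OF i]]]) (use sub F in auto)
  qed
  also have "\<dots> \<le> (\<Sum>i\<in>B. measure_pmf.prob ?D {c. X i c} * \<delta>)"
    by (intro sum_mono mult_left_mono \<delta>) auto
  also have "\<dots> = (\<Sum>i\<in>B. measure_pmf.prob ?D {c. X i c}) * \<delta>" by (simp add: sum_distrib_right)
  \<comment> \<open>These events are disjoint, so the error is a single \<open>\<delta>\<close>. A
    plain union bound would cost one \<open>\<delta>\<close> per element of \<open>B\<close>, too
    much for blocks of more than about the square root of \<open>n\<close> vertices.\<close>
  also have "(\<Sum>i\<in>B. measure_pmf.prob ?D {c. X i c}) = measure_pmf.prob ?D (\<Union>i\<in>B. {c. X i c})"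
  proof (rule measure_pmf.finite_measure_finite_Union[symmetric])
    show "disjoint_family_on (\<lambda>i. {c. X i c}) B"
      unfolding disjoint_family_on_def X_def by (auto dest: neqE)
  qed (use fin in auto)
  also have "\<dots> * \<delta> \<le> 1 * \<delta>" using \<open>0 \<le> \<delta>\<close> by (intro mult_right_mono) auto
  finally show ?thesis by simp
qed

section \<open>The neighbourhood of a single vertex\<close>

lemma prob_Pi_pmf_multinomial:
  assumes fin: "finite A" and U: "U \<subseteq> A" and \<nu>: "\<And>e. e \<in> U \<Longrightarrow> P e = \<nu>" and disj: "S0 \<inter> S1 = {}"
  shows "measure_pmf.prob (Pi_pmf A d P)
           {c. (\<forall>e\<in>U. c e \<in> S0 \<union> S1) \<and> card {e \<in> U. c e \<notin> S0} = m} =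
         real (card U choose m) * measure_pmf.prob \<nu> S1 ^ m * measure_pmf.prob \<nu> S0 ^ (card U - m)"
proof -
  let ?D = "Pi_pmf A d P"
  \<comment> \<open>The event is split according to the set \<open>Y\<close> of coordinates falling
    into \<open>S1\<close>; the others must fall into \<open>S0\<close>, and values outside
    \<open>S0 \<union> S1\<close> are excluded throughout.\<close>
  define \<Y> where "\<Y> = {Y. Y \<subseteq> U \<and> card Y = m}"
  define B where "B = (\<lambda>Y e. if e \<in> Y then S1 else if e \<in> U then S0 else UNIV)"
  have finU: "finite U" using U fin finite_subset by blast
  then have fin\<Y>: "finite \<Y>" unfolding \<Y>_def by (rule_tac finite_subset[of _ "Pow U"]) auto
  have Y: "c \<in> Pi A (B Y) \<longleftrightarrow> (\<forall>e\<in>U. c e \<in> S0 \<union> S1) \<and> {e \<in> U. c e \<notin> S0} = Y" if "Y \<subseteq> U" for c Y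
    using that U disj unfolding Pi_iff B_def by (auto split: if_splits)
  have "{c. (\<forall>e\<in>U. c e \<in> S0 \<union> S1) \<and> card {e \<in> U. c e \<notin> S0} = m} = (\<Union>Y\<in>\<Y>. Pi A (B Y))"
    using Y by (auto simp: \<Y>_def)
  also have "measure_pmf.prob ?D \<dots> = (\<Sum>Y\<in>\<Y>. measure_pmf.prob ?D (Pi A (B Y)))"
  proof (rule measure_pmf.finite_measure_finite_Union[OF fin\<Y>])
    show "disjoint_family_on (\<lambda>Y. Pi A (B Y)) \<Y>"
      unfolding disjoint_family_on_def
    proof (intro ballI impI)
      fix Y Y' assume YY: "Y \<in> \<Y>" "Y' \<in> \<Y>" "Y \<noteq> Y'"
      then have sub: "Y \<subseteq> U" "Y' \<subseteq> U" by (auto simp: \<Y>_def)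
      show "Pi A (B Y) \<inter> Pi A (B Y') = {}"
        unfolding disjoint_iff using Y[OF sub(1)] Y[OF sub(2)] YY(3) by blast
    qed
  qed auto
  also have "\<dots> = (\<Sum>Y\<in>\<Y>. measure_pmf.prob \<nu> S1 ^ m * measure_pmf.prob \<nu> S0 ^ (card U - m))"
  proof (rule sum.cong[OF refl])
    fix Y assume "Y \<in> \<Y>"
    then have YU: "Y \<subseteq> U" "card Y = m" by (auto simp: \<Y>_def)
    have "measure_pmf.prob ?D (Pi A (B Y)) = (\<Prod>e\<in>A. measure_pmf.prob (P e) (B Y e))"
      by (rule measure_Pi_pmf_Pi[OF fin])
    also have "\<dots> = (\<Prod>e\<in>U. measure_pmf.prob (P e) (B Y e))"
      using U YU by (intro prod.mono_neutral_right fin) (auto simp: B_def)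
    also have "\<dots> = (\<Prod>e\<in>U. if e \<in> Y then measure_pmf.prob \<nu> S1 else measure_pmf.prob \<nu> S0)"
      by (intro prod.cong) (auto simp: B_def \<nu>)
    also have "\<dots> = measure_pmf.prob \<nu> S1 ^ card (U \<inter> Y) * measure_pmf.prob \<nu> S0 ^ card (U \<inter> - Y)"
      using finU by (simp add: prod.If_cases)
    also have "U \<inter> Y = Y" using YU by auto
    also have "U \<inter> - Y = U - Y" by auto
    also have "card (U - Y) = card U - m"
      using YU finU finite_subset by (subst card_Diff_subset) auto
    finally show "measure_pmf.prob ?D (Pi A (B Y)) =
      measure_pmf.prob \<nu> S1 ^ m * measure_pmf.prob \<nu> S0 ^ (card U - m)" using YU by simp
  qed
  also have "\<dots> = real (card U choose m) * (measure_pmf.prob \<nu> S1 ^ m * measure_pmf.prob \<nu> S0 ^ (card U - m))"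
    using n_subsets[OF finU, of m] by (simp add: \<Y>_def)
  finally show ?thesis by (simp add: mult.assoc)
qed

lemma prob_random_subset_avoid:
  assumes "finite A" "T \<subseteq> A" "0 \<le> s" "s \<le> 1"
  shows "measure_pmf.prob (random_subset A (\<lambda>_. s)) {X. X \<inter> T = {}} = (1 - s) ^ card T"
proof -
  have "Collect -` {X. X \<inter> T = {}} = Pi A (\<lambda>x. if x \<in> T then {False} else UNIV)"
    using assms(2) by (auto split: if_splits)
  then have "measure_pmf.prob (random_subset A (\<lambda>_. s)) {X. X \<inter> T = {}} =
     (\<Prod>x\<in>A. measure_pmf.prob (bernoulli_pmf s) (if x \<in> T then {False} else UNIV))"
    by (simp add: random_subset_Collect[OF assms(1)] measure_Pi_pmf_Pi[OF assms(1)])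
  also have "\<dots> = (\<Prod>x\<in>T. measure_pmf.prob (bernoulli_pmf s) {False})"
    using assms by (intro prod.mono_neutral_cong_right) auto
  finally show ?thesis using assms by (simp add: measure_pmf_single)
qed

text \<open>Invisibility outside \<open>T\<close> means that there is no parent edge or that it is
  deleted in all \<open>K - card T\<close> copies concerned. Visibility only outside
  \<open>T\<close> means that the parent edge avoids \<open>T\<close> but does not avoid every
  copy.\<close>

lemma
  assumes w: "0 \<le> w" "w \<le> 1" and s: "0 \<le> s" "s \<le> 1" and T: "T \<subseteq> {1..K}"
  shows prob_edge_law_subset:
      "measure_pmf.prob (edge_law K s w) {k. k \<subseteq> T} = 1 - w * (1 - (1 - s) ^ (K - card T))"
    and prob_edge_law_disjoint:
      "measure_pmf.prob (edge_law K s w) {k. k \<inter> T = {} \<and> \<not> k \<subseteq> T} =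
         w * ((1 - s) ^ card T - (1 - s) ^ K)"
proof -
  let ?R = "random_subset {1..K} (\<lambda>_. s)"
  have mix: "measure_pmf.prob (edge_law K s w) Z = w * measure_pmf.prob ?R Z + (1 - w) * indicator Z {}" for Z
    using w by (simp add: edge_law_def prob_bind_pmf indicator_def)
  have supp: "X \<subseteq> {1..K}" if "X \<in> set_pmf ?R" for X
    using that by (auto simp: random_subset_def)
  have cong: "measure_pmf.prob ?R Z = measure_pmf.prob ?R Z'"
    if "\<And>X. X \<subseteq> {1..K} \<Longrightarrow> X \<in> Z \<longleftrightarrow> X \<in> Z'" for Z Z'
    using supp that by (intro measure_prob_cong_0) (metis DiffD1 DiffD2 pmf_eq_0_set_pmf)+
  have "measure_pmf.prob ?R {k. k \<subseteq> T} = measure_pmf.prob ?R {k. k \<inter> ({1..K} - T) = {}}"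
    by (rule cong) auto
  also have "\<dots> = (1 - s) ^ (K - card T)"
    using prob_random_subset_avoid[of "{1..K}" "{1..K} - T" s] s T
    by (simp add: card_Diff_subset finite_subset)
  finally show "measure_pmf.prob (edge_law K s w) {k. k \<subseteq> T} = 1 - w * (1 - (1 - s) ^ (K - card T))"
    by (simp add: mix algebra_simps)
  have "measure_pmf.prob ?R {k. k \<inter> T = {} \<and> \<not> k \<subseteq> T} =
        measure_pmf.prob ?R ({k. k \<inter> T = {}} - {k. k \<inter> {1..K} = {}})"
    using T by (intro cong) auto
  also have "\<dots> = measure_pmf.prob ?R {k. k \<inter> T = {}} - measure_pmf.prob ?R {k. k \<inter> {1..K} = {}}"
    using T by (intro measure_pmf.finite_measure_Diff) auto
  also have "\<dots> = (1 - s) ^ card T - (1 - s) ^ K"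
    using s T by (simp only: prob_random_subset_avoid finite_atLeastAtMost order.refl) simp
  finally show "measure_pmf.prob (edge_law K s w) {k. k \<inter> T = {} \<and> \<not> k \<subseteq> T} =
         w * ((1 - s) ^ card T - (1 - s) ^ K)"
    by (simp add: mix)
qed

text \<open>The two factors belong to neighbours of equal and of opposite label, \<open>N\<close>
  and \<open>N'\<close> being the numbers of candidates. Given a parent edge,
  \<open>\<alpha>\<close> is the probability of being visible only outside \<open>T\<close>, and
  \<open>\<eta>\<close> that of being visible outside \<open>T\<close> at all. Edges visible on both
  sides of \<open>T\<close> are forbidden, so the factors are not binomial probabilities unless
  \<open>\<alpha> = \<eta>\<close>.\<close>

definition good_prob :: "real \<Rightarrow> real \<Rightarrow> real \<Rightarrow> real \<Rightarrow> nat \<Rightarrow> nat \<Rightarrow> nat \<Rightarrow> real" where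
  "good_prob \<alpha> \<eta> p q m N N' =
     (real (N choose m) * (p * \<alpha>) ^ m * (1 - p * \<eta>) ^ (N - m)) *
     (real (N' choose m) * (q * \<alpha>) ^ m * (1 - q * \<eta>) ^ (N' - m))"

text \<open>Pairs joining \<open>i\<close> to vertices of its own label and of the other label are
  disjoint sets of coordinates with constant parameters \<open>p\<close> and \<open>q\<close>, so
  the two counts are independent.\<close>

lemma prob_balanced_neighbourhood:
  assumes pq: "0 < p" "p < 1" "0 < q" "q < 1" and s: "0 \<le> s" "s \<le> 1" and T: "T \<subseteq> {1..K}"
    and i: "i \<in> {1..n}" "i \<notin> R" and R: "R \<subseteq> {1..n}"
  shows "measure_pmf.prob (pattern_law K n p q s \<sigma>)
     {c. (\<forall>u\<in>R. c {i, u} \<subseteq> T \<or> c {i, u} \<inter> T = {}) \<and>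
         card {u \<in> R. \<sigma> u = \<sigma> i \<and> \<not> c {i, u} \<subseteq> T} = m \<and>
         card {u \<in> R. \<sigma> u \<noteq> \<sigma> i \<and> \<not> c {i, u} \<subseteq> T} = m} =
     good_prob ((1 - s) ^ card T - (1 - s) ^ K) (1 - (1 - s) ^ (K - card T)) p q m
       (card {u \<in> R. \<sigma> u = \<sigma> i}) (card {u \<in> R. \<sigma> u \<noteq> \<sigma> i})"
proof -
  let ?D = "pattern_law K n p q s \<sigma>"
  define S0 where "S0 = {k. k \<subseteq> T}"
  define S1 where "S1 = {k. k \<inter> T = {} \<and> \<not> k \<subseteq> T}"
  define U where "U = (\<lambda>X. (\<lambda>u. {i, u}) ` {u \<in> R. X u})"
  define Q where "Q = (\<lambda>X c. (\<forall>e\<in>U X. c e \<in> S0 \<union> S1) \<and> card {e \<in> U X. c e \<notin> S0} = m)"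
  let ?s = "\<lambda>u. \<sigma> u = \<sigma> i" and ?d = "\<lambda>u. \<sigma> u \<noteq> \<sigma> i"
  have inj: "inj_on (\<lambda>u. {i, u}) Z" if "Z \<subseteq> R" for Z
    using i that by (auto simp: inj_on_def doubleton_eq_iff)
  have Usub: "U X \<subseteq> vertex_pairs n" for X
    using i R by (auto simp: U_def vertex_pairs_def card_2_iff)
  have cardU: "card (U X) = card {u \<in> R. X u}" for X
    unfolding U_def by (rule card_image[OF inj]) auto
  have cardQ: "card {e \<in> U X. c e \<notin> S0} = card {u \<in> R. X u \<and> \<not> c {i, u} \<subseteq> T}" for X and c :: "nat set \<Rightarrow> nat set"
  proof -
    have "{e \<in> U X. c e \<notin> S0} = (\<lambda>u. {i, u}) ` {u \<in> R. X u \<and> \<not> c {i, u} \<subseteq> T}"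
      by (auto simp: U_def S0_def)
    then show ?thesis by (simp add: card_image inj)
  qed
  have dep: "depends_on (Q X) (U X)" for X
    unfolding depends_on_def
  proof (intro allI impI)
    fix c c' :: "nat set \<Rightarrow> nat set" assume *: "\<forall>e\<in>U X. c e = c' e"
    then have "{e \<in> U X. c e \<notin> S0} = {e \<in> U X. c' e \<notin> S0}" by auto
    then show "Q X c = Q X c'" unfolding Q_def using * by simp
  qed
  have disj: "U ?s \<inter> U ?d = {}" using i by (auto simp: U_def doubleton_eq_iff)
  have "{c. (\<forall>u\<in>R. c {i, u} \<subseteq> T \<or> c {i, u} \<inter> T = {}) \<and>
         card {u \<in> R. \<sigma> u = \<sigma> i \<and> \<not> c {i, u} \<subseteq> T} = m \<and>
         card {u \<in> R. \<sigma> u \<noteq> \<sigma> i \<and> \<not> c {i, u} \<subseteq> T} = m} = {c. Q ?s c \<and> Q ?d c}"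
  proof -
    have "(\<forall>e\<in>U ?s. c e \<in> S0 \<union> S1) \<and> (\<forall>e\<in>U ?d. c e \<in> S0 \<union> S1) \<longleftrightarrow>
          (\<forall>u\<in>R. c {i, u} \<subseteq> T \<or> c {i, u} \<inter> T = {})" for c
      by (auto simp: U_def S0_def S1_def)
    then show ?thesis unfolding Q_def cardQ by blast
  qed
  also have "measure_pmf.prob ?D {c. Q ?s c \<and> Q ?d c} =
      measure_pmf.prob ?D {c. Q ?s c} * measure_pmf.prob ?D {c. Q ?d c}"
    unfolding pattern_law_def by (rule prob_Pi_pmf_conj[OF _ Usub disj dep dep]) simp
  also have "measure_pmf.prob ?D {c. Q ?s c} =
     real (card (U ?s) choose m) * measure_pmf.prob (edge_law K s p) S1 ^ m *
       measure_pmf.prob (edge_law K s p) S0 ^ (card (U ?s) - m)"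
    unfolding pattern_law_def Q_def
    by (rule prob_Pi_pmf_multinomial) (use Usub in \<open>auto simp: U_def S0_def S1_def edge_weight_def\<close>)
  also have "measure_pmf.prob ?D {c. Q ?d c} =
     real (card (U ?d) choose m) * measure_pmf.prob (edge_law K s q) S1 ^ m *
       measure_pmf.prob (edge_law K s q) S0 ^ (card (U ?d) - m)"
    unfolding pattern_law_def Q_def
    by (rule prob_Pi_pmf_multinomial) (use Usub in \<open>auto simp: U_def S0_def S1_def edge_weight_def\<close>)
  finally show ?thesis
    unfolding S0_def S1_def cardU good_prob_def using pq s T
    by (simp add: prob_edge_law_subset prob_edge_law_disjoint)
qed

text \<open>Goodness is split into \<open>Q\<close>, about pairs from \<open>i\<close> into
  \<open>R\<close>, and \<open>W\<close>, about pairs inside \<open>S\<close>. The former are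
  independent for different \<open>i\<close> and independent of the latter; the failure of
  \<open>W\<close> is bounded by the expected number of parent edges from \<open>i\<close> into
  \<open>S\<close>.\<close>

lemma prob_no_good:
  assumes pq: "0 < p" "p < 1" "0 < q" "q < 1" and s: "0 \<le> s" "s \<le> 1" and T: "T \<subseteq> {1..K}"
    and SR: "S \<union> R = {1..n}" "S \<inter> R = {}" and B: "B \<subseteq> S" and l: "\<And>i. i \<in> B \<Longrightarrow> \<sigma> i = l"
  shows "measure_pmf.prob (pattern_law K n p q s \<sigma>) {c. \<forall>i\<in>B. \<not> good T S R m \<sigma> c i} \<le>
     exp (- good_prob ((1 - s) ^ card T - (1 - s) ^ K) (1 - (1 - s) ^ (K - card T)) p q m
        (card {u \<in> R. \<sigma> u = l}) (card {u \<in> R. \<sigma> u \<noteq> l}) * real (card B)) +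
     real (card S) * max p q"
proof -
  let ?D = "pattern_law K n p q s \<sigma>"
  define W where "W = (\<lambda>i (c :: nat set \<Rightarrow> nat set). \<forall>u\<in>S - {i}. c {i, u} \<subseteq> T)"
  define Q where "Q = (\<lambda>i c. (\<forall>u\<in>R. c {i, u} \<subseteq> T \<or> c {i, u} \<inter> T = {}) \<and>
         card {u \<in> R. \<sigma> u = \<sigma> i \<and> \<not> c {i, u} \<subseteq> T} = m \<and>
         card {u \<in> R. \<sigma> u \<noteq> \<sigma> i \<and> \<not> c {i, u} \<subseteq> T} = m)"
  define E where "E = (\<lambda>i. (\<lambda>u. {i, u}) ` R)"
  \<comment> \<open>Sets that are not vertex pairs do no harm here: the pattern is constantly
    \<open>{}\<close> on them.\<close>
  define F where "F = {e. e \<subseteq> S}"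
  have fin: "finite S" "finite R" using SR by (metis finite_Un finite_atLeastAtMost)+
  have finB: "finite B" using B fin finite_subset by blast
  have nW: "measure_pmf.prob ?D {c. \<not> W i c} \<le> real (card S) * max p q" if "i \<in> B" for i
  proof -
    have "{c. \<not> W i c} \<subseteq> (\<Union>u\<in>S - {i}. {c. \<not> c {i, u} \<subseteq> T})" by (auto simp: W_def)
    then have "measure_pmf.prob ?D {c. \<not> W i c} \<le> measure_pmf.prob ?D (\<Union>u\<in>S - {i}. {c. \<not> c {i, u} \<subseteq> T})"
      by (intro measure_pmf.finite_measure_mono) auto
    also have "\<dots> \<le> (\<Sum>u\<in>S - {i}. measure_pmf.prob ?D {c. \<not> c {i, u} \<subseteq> T})"
      by (rule measure_UNION_le) (use fin in auto)
    also have "\<dots> \<le> (\<Sum>u\<in>S - {i}. max p q)"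
    proof (rule sum_mono)
      fix u assume u: "u \<in> S - {i}"
      let ?e = "{i, u}"
      let ?w = "edge_weight p q \<sigma> ?e"
      have e: "?e \<in> vertex_pairs n" using u that B SR by (auto simp: vertex_pairs_def)
      have w: "0 \<le> ?w" "?w \<le> 1" "?w \<le> max p q" using pq by (auto simp: edge_weight_def)
      have "measure_pmf.prob ?D {c. \<not> c ?e \<subseteq> T} = measure_pmf.prob (map_pmf (\<lambda>c. c ?e) ?D) {k. \<not> k \<subseteq> T}"
        by (simp add: vimage_def)
      also have "map_pmf (\<lambda>c. c ?e) ?D = edge_law K s ?w"
        unfolding pattern_law_def by (subst Pi_pmf_component) (use e in auto)
      also have "measure_pmf.prob (edge_law K s ?w) {k. \<not> k \<subseteq> T} =
                 1 - measure_pmf.prob (edge_law K s ?w) {k. k \<subseteq> T}"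
        using measure_pmf.prob_compl[of "{k. k \<subseteq> T}" "edge_law K s ?w"] by (simp add: Collect_neg_eq Compl_eq_Diff_UNIV)
      also have "\<dots> = ?w * (1 - (1 - s) ^ (K - card T))"
        using prob_edge_law_subset[OF w(1,2) s T] by simp
      also have "\<dots> \<le> ?w * 1" using w s by (intro mult_left_mono) auto
      finally show "measure_pmf.prob ?D {c. \<not> c ?e \<subseteq> T} \<le> max p q" using w by simp
    qed
    also have "\<dots> = real (card (S - {i})) * max p q" by simp
    also have "\<dots> \<le> real (card S) * max p q"
      using pq fin by (intro mult_right_mono) (auto intro: card_mono)
    finally show ?thesis .
  qed
  have "good T S R m \<sigma> c i \<longleftrightarrow> W i c \<and> Q i c" for c i by (simp add: good_def W_def Q_def)
  then have "measure_pmf.prob ?D {c. \<forall>i\<in>B. \<not> good T S R m \<sigma> c i} =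
        measure_pmf.prob ?D {c. \<forall>i\<in>B. \<not> (W i c \<and> Q i c)}" by simp
  also have "\<dots> \<le> (\<Prod>i\<in>B. 1 - measure_pmf.prob ?D {c. Q i c}) + real (card S) * max p q"
    unfolding pattern_law_def
  proof (rule prob_no_joint_success[where E = E and F = F])
    fix i assume i: "i \<in> B"
    then have iS: "i \<in> S" "i \<notin> R" "i \<in> {1..n}" using B SR by auto
    show "E i \<subseteq> vertex_pairs n"
      using iS SR by (auto simp: E_def vertex_pairs_def card_2_iff)
    show "E i \<inter> E j = {}" if "j \<in> B" "i \<noteq> j" for j
      using iS that B SR by (auto simp: E_def doubleton_eq_iff)
    show "E i \<inter> F = {}" using SR by (auto simp: E_def F_def)
    show "depends_on (Q i) (E i)"
      unfolding depends_on_def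
    proof (intro allI impI)
      fix c c' :: "nat set \<Rightarrow> nat set" assume "\<forall>e\<in>E i. c e = c' e"
      then have *: "c {i, u} = c' {i, u}" if "u \<in> R" for u using that by (auto simp: E_def)
      then have "{u \<in> R. \<sigma> u = \<sigma> i \<and> \<not> c {i, u} \<subseteq> T} = {u \<in> R. \<sigma> u = \<sigma> i \<and> \<not> c' {i, u} \<subseteq> T}"
        "{u \<in> R. \<sigma> u \<noteq> \<sigma> i \<and> \<not> c {i, u} \<subseteq> T} = {u \<in> R. \<sigma> u \<noteq> \<sigma> i \<and> \<not> c' {i, u} \<subseteq> T}" by auto
      then show "Q i c = Q i c'" unfolding Q_def using * by simp
    qed
    show "depends_on (W i) F"
      unfolding depends_on_def
    proof (intro allI impI)
      fix c c' :: "nat set \<Rightarrow> nat set" assume *: "\<forall>e\<in>F. c e = c' e"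
      have "c {i, u} = c' {i, u}" if "u \<in> S" for u
        using * that iS by (auto simp: F_def)
      then show "W i c = W i c'" unfolding W_def by auto
    qed
  next
    show "measure_pmf.prob (Pi_pmf (vertex_pairs n) {} (\<lambda>e. edge_law K s (edge_weight p q \<sigma> e)))
        {c. \<not> W i c} \<le> real (card S) * max p q" if "i \<in> B" for i
      using nW[OF that] by (simp add: pattern_law_def)
    show "0 \<le> real (card S) * max p q" using pq by auto
  qed (use finB in auto)
  also have "(\<Prod>i\<in>B. 1 - measure_pmf.prob ?D {c. Q i c}) \<le>
    (\<Prod>i\<in>B. exp (- good_prob ((1 - s) ^ card T - (1 - s) ^ K) (1 - (1 - s) ^ (K - card T)) p q m
        (card {u \<in> R. \<sigma> u = l}) (card {u \<in> R. \<sigma> u \<noteq> l})))"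
  proof (rule prod_mono)
    fix i assume i: "i \<in> B"
    have iR: "i \<in> {1..n}" "i \<notin> R" "R \<subseteq> {1..n}" using i B SR by auto
    have eq: "measure_pmf.prob ?D {c. Q i c} =
      good_prob ((1 - s) ^ card T - (1 - s) ^ K) (1 - (1 - s) ^ (K - card T)) p q m
       (card {u \<in> R. \<sigma> u = \<sigma> i}) (card {u \<in> R. \<sigma> u \<noteq> \<sigma> i})"
      unfolding Q_def by (rule prob_balanced_neighbourhood[OF pq s T iR])
    have "1 - x \<le> exp (- x)" for x :: real using exp_ge_add_one_self[of "- x"] by simp
    then show "0 \<le> 1 - measure_pmf.prob ?D {c. Q i c} \<and> 1 - measure_pmf.prob ?D {c. Q i c} \<le>
        exp (- good_prob ((1 - s) ^ card T - (1 - s) ^ K) (1 - (1 - s) ^ (K - card T)) p q m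
        (card {u \<in> R. \<sigma> u = l}) (card {u \<in> R. \<sigma> u \<noteq> l}))"
      unfolding eq[unfolded l[OF i], symmetric] by simp
  qed
  also have "\<dots> = exp (- good_prob ((1 - s) ^ card T - (1 - s) ^ K) (1 - (1 - s) ^ (K - card T)) p q m
        (card {u \<in> R. \<sigma> u = l}) (card {u \<in> R. \<sigma> u \<noteq> l}) * real (card B))"
    by (simp add: exp_of_nat_mult[symmetric] mult.commute)
  finally show ?thesis by simp
qed

subsection \<open>Asymptotics of the probability of being good\<close>

lemma binomial_ge_power_div_fact: "real (N - m) ^ m / fact m \<le> real (N choose m)"
proof (induction m)
  case (Suc m)
  have "real (N - Suc m) ^ Suc m / fact (Suc m) \<le> real (N - m) ^ Suc m / fact (Suc m)"
    by (intro divide_right_mono power_mono) auto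
  also have "\<dots> = (real (N - m) ^ m / fact m) * (real (N - m) / real (Suc m))" by (simp add: mult_ac)
  also have "\<dots> \<le> real (N choose m) * (real (N - m) / real (Suc m))"
    by (intro mult_right_mono Suc.IH) auto
  also have "\<dots> = real (N choose Suc m)"
  proof -
    have "Suc m * (N choose Suc m) = (N - m) * (N choose m)" by (simp only: binomial_absorption binomial_absorb_comp)
    then have "real (Suc m) * real (N choose Suc m) = real (N - m) * real (N choose m)"
      by (metis of_nat_mult)
    then show ?thesis by (simp add: field_simps)
  qed
  finally show ?case .
qed simp

text \<open>A crude Stirling bound. The induction step needs e \<le> ((m+2)/(m+1))^(m+2), which
  follows from ln y \<le> y - 1 at y = (m+1)/(m+2).\<close>

lemma fact_le_power_exp: "fact m \<le> (real m + 1) ^ (m + 1) * exp (- real m)"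
proof (induction m)
  case (Suc m)
  have "exp 1 \<le> ((real m + 2) / (real m + 1)) ^ (m + 2)"
  proof -
    have "1 / (real m + 2) \<le> ln ((real m + 2) / (real m + 1))"
    proof -
      have "ln ((real m + 1) / (real m + 2)) \<le> (real m + 1) / (real m + 2) - 1"
        by (rule ln_le_minus_one) auto
      also have "\<dots> = - (1 / (real m + 2))" by (simp add: field_simps)
      finally show ?thesis by (simp add: ln_div)
    qed
    then have "1 \<le> real (m + 2) * ln ((real m + 2) / (real m + 1))"
      by (simp add: field_simps)
    then have "exp 1 \<le> exp (real (m + 2) * ln ((real m + 2) / (real m + 1)))" by simp
    also have "\<dots> = ((real m + 2) / (real m + 1)) ^ (m + 2)"
      by (subst exp_of_nat_mult) simp
    finally show ?thesis .
  qed
  then have e: "exp 1 * (real m + 1) ^ (m + 2) \<le> (real m + 2) ^ (m + 2)"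
    unfolding power_divide by (subst (asm) pos_le_divide_eq) auto
  have "fact (Suc m) = (real m + 1) * fact m" by simp
  also have "\<dots> \<le> (real m + 1) * ((real m + 1) ^ (m + 1) * exp (- real m))"
    by (intro mult_left_mono Suc.IH) auto
  also have "\<dots> = exp 1 * (real m + 1) ^ (m + 2) * exp (- real (Suc m))"
    by (simp add: exp_diff exp_minus field_simps)
  also have "\<dots> \<le> (real m + 2) ^ (m + 2) * exp (- real (Suc m))"
    by (intro mult_right_mono e) auto
  finally show ?case by (simp add: add.commute)
qed simp

text \<open>The largest term of the exponential series has index near \<open>z\<close> and carries
  the whole sum up to a factor linear in \<open>z\<close>. Of the two units lost in the exponent,
  one pays for replacing \<open>m + 1\<close> by \<open>m\<close> in the base of the power, the
  other for rounding \<open>z\<close> down.\<close>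

lemma exp_series_max_term:
  fixes z :: real
  assumes "0 \<le> z"
  defines "m \<equiv> nat \<lfloor>z\<rfloor>"
  shows "exp (z - 2) / (z + 1) \<le> z ^ m / fact m"
proof -
  have mz: "real m \<le> z" "z \<le> real m + 1" using assms by (auto simp: m_def)
  have "(real m + 1) ^ m \<le> exp 1 * real m ^ m"
  proof (cases "m = 0")
    case False
    have "(1 + 1 / real m) ^ m \<le> exp 1"
    proof -
      have "(1 + 1 / real m) ^ m \<le> exp (1 / real m) ^ m"
        by (intro power_mono) (auto intro: exp_ge_add_one_self)
      also have "\<dots> = exp 1" using False by (simp add: exp_of_nat_mult[symmetric])
      finally show ?thesis .
    qed
    moreover have "(real m + 1) ^ m = (1 + 1 / real m) ^ m * real m ^ m"
      using False by (simp add: power_mult_distrib[symmetric] field_simps)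
    ultimately show ?thesis by (simp add: mult_right_mono)
  qed simp
  also have "\<dots> \<le> exp 1 * z ^ m" using mz by (intro mult_left_mono power_mono) auto
  finally have 1: "(real m + 1) ^ m \<le> exp 1 * z ^ m" .
  have "fact m * exp (z - 2) \<le> ((real m + 1) ^ (m + 1) * exp (- real m)) * exp (z - 2)"
    by (intro mult_right_mono fact_le_power_exp) auto
  also have "\<dots> = (real m + 1) ^ m * (real m + 1) * exp (z - real m - 2)"
  proof -
    have "exp (- real m) * exp (z - 2) = exp (z - real m - 2)" by (simp add: exp_add[symmetric])
    then show ?thesis by (simp add: mult_ac)
  qed
  also have "\<dots> \<le> (exp 1 * z ^ m) * (z + 1) * exp (- 1)"
    using mz assms(1) by (intro mult_mono 1) auto
  also have "\<dots> = z ^ m * (z + 1)" by (simp add: exp_minus)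
  finally show ?thesis using assms by (simp add: field_simps)
qed

lemma one_minus_power_ge_exp:
  assumes "0 \<le> x" "x < (1::real)" "k \<le> N"
  shows "exp (- (x * real N / (1 - x))) \<le> (1 - x) ^ k"
proof -
  have "ln (1 / (1 - x)) \<le> 1 / (1 - x) - 1" using assms by (intro ln_le_minus_one) auto
  also have "\<dots> = x / (1 - x)" using assms by (simp add: field_simps)
  finally have "- (x / (1 - x)) \<le> ln (1 - x)" using assms by (simp add: ln_div)
  then have "real N * (- (x / (1 - x))) \<le> real N * ln (1 - x)" by (intro mult_left_mono) auto
  then have "exp (- (x * real N / (1 - x))) \<le> exp (real N * ln (1 - x))" by (simp add: mult.commute)
  also have "\<dots> = (1 - x) ^ N" using assms by (simp add: exp_of_nat_mult)
  also have "\<dots> \<le> (1 - x) ^ k" using assms by (intro power_decreasing) auto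
  finally show ?thesis .
qed

text \<open>The product of the two binomial terms has the form (x y)^m / (m!)^2, with x and y close
  to the expected numbers of neighbours of either kind. It is nearly maximal when \<open>m\<close>
  is their geometric mean, and this is where \<open>sqrt (a * b)\<close> comes from.\<close>

lemma good_prob_ge:
  assumes \<epsilon>: "0 < \<epsilon>" "\<epsilon> < 1/2" and ab: "a > 0" "b > 0" and \<alpha>: "0 \<le> \<alpha>" and \<eta>: "0 \<le> \<eta>"
    and L: "0 \<le> L" and n: "n > 0"
    and N: "(1 - \<epsilon>) * real n / 2 \<le> real N" "real N \<le> (1 + \<epsilon>) * real n / 2"
    and N': "(1 - \<epsilon>) * real n / 2 \<le> real N'" "real N' \<le> (1 + \<epsilon>) * real n / 2"
  defines "p \<equiv> a * L / real n" and "q \<equiv> b * L / real n"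
  defines "z \<equiv> (1 - 2 * \<epsilon>) * \<alpha> * sqrt (a * b) / 2 * L"
  defines "m \<equiv> nat \<lfloor>z\<rfloor>"
  assumes m: "real m \<le> \<epsilon> * real n / 2"
    and x: "p * \<eta> < 1" "1 / (1 - p * \<eta>) \<le> 1 + \<epsilon>" "q * \<eta> < 1" "1 / (1 - q * \<eta>) \<le> 1 + \<epsilon>"
  shows "exp (- (((1 + \<epsilon>)\<^sup>2 * \<eta> * (a + b) / 2 - (1 - 2 * \<epsilon>) * \<alpha> * sqrt (a * b)) * L)) *
           exp (- 4) / (z + 1)\<^sup>2 \<le> good_prob \<alpha> \<eta> p q m N N'"
proof -
  have z0: "0 \<le> z" using \<epsilon> ab \<alpha> L by (auto simp: z_def)
  have pq0: "0 \<le> p" "0 \<le> q" using ab L by (auto simp: p_def q_def)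
  \<comment> \<open>A lower bound for \<open>N - m\<close> and \<open>N' - m\<close>: one
    \<open>\<epsilon>\<close> is lost through the imbalance of the labels, the other through
    \<open>m\<close>.\<close>
  define r where "r = (1 - 2 * \<epsilon>) * real n / 2"
  have r0: "0 \<le> r" using \<epsilon> by (simp add: r_def)
  have choose: "r ^ m / fact m \<le> real (k choose m)" if "(1 - \<epsilon>) * real n / 2 \<le> real k" for k
  proof -
    have "r \<le> real k - real m" using that m by (simp add: r_def field_simps)
    then have "r \<le> real (k - m)" by linarith
    then have "r ^ m / fact m \<le> real (k - m) ^ m / fact m"
      using r0 by (intro divide_right_mono power_mono) auto
    also have "\<dots> \<le> real (k choose m)" by (rule binomial_ge_power_div_fact)
    finally show ?thesis .
  qed
  \<comment> \<open>The square of \<open>1 + \<epsilon>\<close> collects the upper bound on the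
    number of candidates and the error of replacing \<open>1 - y\<close> by an exponential.\<close>
  have pow: "exp (- ((1 + \<epsilon>)\<^sup>2 * \<eta> * d * L / 2)) \<le> (1 - d * L / real n * \<eta>) ^ (k - m)"
    if "0 < d" "d * L / real n * \<eta> < 1" "1 / (1 - d * L / real n * \<eta>) \<le> 1 + \<epsilon>"
      "real k \<le> (1 + \<epsilon>) * real n / 2" for d k
  proof -
    define y where "y = d * L / real n * \<eta>"
    have y0: "0 \<le> y" using that L \<eta> by (simp add: y_def)
    have "y * real k / (1 - y) = y * real k * (1 / (1 - y))" by simp
    also have "\<dots> \<le> y * ((1 + \<epsilon>) * real n / 2) * (1 + \<epsilon>)"
      using that y0 \<epsilon> L \<eta> by (intro mult_mono) (auto simp: y_def)
    also have "\<dots> = (1 + \<epsilon>)\<^sup>2 * \<eta> * d * L / 2"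
      using n by (simp add: y_def power2_eq_square field_simps)
    finally have "exp (- ((1 + \<epsilon>)\<^sup>2 * \<eta> * d * L / 2)) \<le> exp (- (y * real k / (1 - y)))" by simp
    also have "\<dots> \<le> (1 - y) ^ (k - m)"
      using y0 that by (intro one_minus_power_ge_exp) (auto simp: y_def)
    finally show ?thesis by (simp add: y_def)
  qed
  have rr: "(r * (p * \<alpha>)) * (r * (q * \<alpha>)) = z\<^sup>2"
    using n ab by (simp add: r_def p_def q_def z_def power2_eq_square field_simps real_sqrt_mult)
  have "(exp (z - 2) / (z + 1))\<^sup>2 \<le> (z ^ m / fact m)\<^sup>2"
    using z0 exp_series_max_term[OF z0] unfolding m_def by (intro power_mono) auto
  also have "\<dots> = (z\<^sup>2) ^ m / (fact m)\<^sup>2"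
    by (simp add: power_divide power_mult[symmetric] mult.commute)
  also have "\<dots> = (r ^ m / fact m * (p * \<alpha>) ^ m) * (r ^ m / fact m * (q * \<alpha>) ^ m)"
    unfolding rr[symmetric] by (simp add: power_mult_distrib power2_eq_square field_simps)
  also have "\<dots> \<le> (real (N choose m) * (p * \<alpha>) ^ m) * (real (N' choose m) * (q * \<alpha>) ^ m)"
    using choose[OF N(1)] choose[OF N'(1)] pq0 \<alpha> r0 by (intro mult_mono) auto
  finally have A: "(exp (z - 2) / (z + 1))\<^sup>2 \<le> \<dots>" .
  have Bp: "exp (- ((1 + \<epsilon>)\<^sup>2 * \<eta> * a * L / 2)) \<le> (1 - p * \<eta>) ^ (N - m)"
    using pow[of a N] ab x N unfolding p_def by blast
  have Bq: "exp (- ((1 + \<epsilon>)\<^sup>2 * \<eta> * b * L / 2)) \<le> (1 - q * \<eta>) ^ (N' - m)"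
    using pow[of b N'] ab x N' unfolding q_def by blast
  have B: "exp (- ((1 + \<epsilon>)\<^sup>2 * \<eta> * a * L / 2)) * exp (- ((1 + \<epsilon>)\<^sup>2 * \<eta> * b * L / 2)) \<le>
      (1 - p * \<eta>) ^ (N - m) * (1 - q * \<eta>) ^ (N' - m)"
    using x by (intro mult_mono Bp Bq) auto
  have "exp (- (((1 + \<epsilon>)\<^sup>2 * \<eta> * (a + b) / 2 - (1 - 2 * \<epsilon>) * \<alpha> * sqrt (a * b)) * L)) *
           exp (- 4) / (z + 1)\<^sup>2 =
     (exp (z - 2) / (z + 1))\<^sup>2 *
     (exp (- ((1 + \<epsilon>)\<^sup>2 * \<eta> * a * L / 2)) * exp (- ((1 + \<epsilon>)\<^sup>2 * \<eta> * b * L / 2)))"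
  proof -
    have "exp (z - 2) ^ 2 = exp (2 * z - 4)" by (simp add: exp_double[symmetric] algebra_simps)
    then have "(exp (z - 2) / (z + 1))\<^sup>2 = exp (2 * z - 4) / (z + 1)\<^sup>2" by (simp add: power_divide)
    moreover have "2 * z = (1 - 2 * \<epsilon>) * \<alpha> * sqrt (a * b) * L" by (simp add: z_def)
    ultimately show ?thesis
      by (simp add: exp_add[symmetric]) (simp add: algebra_simps add_divide_distrib)
  qed
  also have "\<dots> \<le> ((real (N choose m) * (p * \<alpha>) ^ m) * (real (N' choose m) * (q * \<alpha>) ^ m)) *
      ((1 - p * \<eta>) ^ (N - m) * (1 - q * \<eta>) ^ (N' - m))"
    using pq0 \<alpha> by (intro mult_mono A B) auto
  also have "\<dots> = good_prob \<alpha> \<eta> p q m N N'" by (simp add: good_prob_def mult_ac)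
  finally show ?thesis .
qed

text \<open>\<open>m\<close> depends on \<open>n\<close> only, while the bound is uniform in
  \<open>N\<close> and \<open>N'\<close>: goodness of vertices of both labels must refer to the same
  \<open>m\<close>, whatever the exact community sizes are.\<close>

lemma good_prob_asymp:
  assumes ab: "a > 0" "b > 0" and \<alpha>: "0 \<le> \<alpha>" and \<eta>: "0 \<le> \<eta>" "\<eta> \<le> 1"
    and \<theta>: "\<eta> * (a + b) / 2 - \<alpha> * sqrt (a * b) < \<theta>"
  obtains \<epsilon> m where "0 < \<epsilon>" "\<epsilon> < 1/2"
    "\<forall>\<^sub>F n in sequentially. \<forall>N N'.
       (1 - \<epsilon>) * real n / 2 \<le> real N \<and> real N \<le> (1 + \<epsilon>) * real n / 2 \<and>
       (1 - \<epsilon>) * real n / 2 \<le> real N' \<and> real N' \<le> (1 + \<epsilon>) * real n / 2 \<longrightarrow>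
       real n powr (- \<theta>) \<le> good_prob \<alpha> \<eta> (a * ln (real n) / real n) (b * ln (real n) / real n) (m n) N N'"
proof -
  let ?f = "\<lambda>\<epsilon>. (1 + \<epsilon>)\<^sup>2 * \<eta> * (a + b) / 2 - (1 - 2 * \<epsilon>) * \<alpha> * sqrt (a * b)"
  have "(?f \<longlongrightarrow> ?f 0) (at_right 0)" by (intro tendsto_intros) simp_all
  then have "\<forall>\<^sub>F \<epsilon> in at_right 0. ?f \<epsilon> < \<theta>" by (rule order_tendstoD(2)) (use \<theta> in simp)
  moreover have "\<forall>\<^sub>F \<epsilon> in at_right 0. \<epsilon> \<in> {0<..<1/2::real}" by (rule eventually_at_right_real) simp
  ultimately have "\<forall>\<^sub>F \<epsilon> in at_right 0. ?f \<epsilon> < \<theta> \<and> \<epsilon> \<in> {0<..<1/2}" by (rule eventually_conj)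
  then obtain \<epsilon> where \<epsilon>: "?f \<epsilon> < \<theta>" "0 < \<epsilon>" "\<epsilon> < 1/2"
    using eventually_happens'[OF trivial_limit_at_right_real] by fastforce
  define \<zeta> where "\<zeta> = (1 - 2 * \<epsilon>) * \<alpha> * sqrt (a * b) / 2"
  have \<zeta>0: "0 \<le> \<zeta>" using \<epsilon> \<alpha> ab by (simp add: \<zeta>_def)
  define m where "m = (\<lambda>n::nat. nat \<lfloor>\<zeta> * ln (real n)\<rfloor>)"
  \<comment> \<open>This slack in the exponent absorbs the loss
    \<open>exp 4 * (z + 1)\<^sup>2\<close>, which is only polylogarithmic in
    \<open>n\<close>.\<close>
  define \<delta> where "\<delta> = \<theta> - ?f \<epsilon>"
  have \<delta>: "\<delta> > 0" using \<epsilon> by (simp add: \<delta>_def)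
  define c where "c = \<zeta> + 1"
  have c: "c > 0" using \<zeta>0 by (simp add: c_def)
  have E1: "\<forall>\<^sub>F n in sequentially. c * ln (real n) \<le> \<epsilon> * real n / 2" using c \<epsilon>(2) by real_asymp
  have E2: "\<forall>\<^sub>F n in sequentially. exp 4 * (c * ln (real n))\<^sup>2 \<le> real n powr \<delta>"
    using c \<delta> by real_asymp
  have E3: "\<forall>\<^sub>F n in sequentially. ln (real n) \<ge> 1" by real_asymp
  \<comment> \<open>The threshold is the value of y for which 1 / (1 - y) = 1 + \<epsilon>.\<close>
  have E4: "\<forall>\<^sub>F n in sequentially. d * ln (real n) / real n \<le> \<epsilon> / (1 + \<epsilon>)" if "d > 0" for d
  proof -
    have "\<epsilon> / (1 + \<epsilon>) > 0" using \<epsilon> by simp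
    then show ?thesis using that by real_asymp
  qed
  have "\<forall>\<^sub>F n in sequentially. \<forall>N N'.
       (1 - \<epsilon>) * real n / 2 \<le> real N \<and> real N \<le> (1 + \<epsilon>) * real n / 2 \<and>
       (1 - \<epsilon>) * real n / 2 \<le> real N' \<and> real N' \<le> (1 + \<epsilon>) * real n / 2 \<longrightarrow>
       real n powr (- \<theta>) \<le> good_prob \<alpha> \<eta> (a * ln (real n) / real n) (b * ln (real n) / real n) (m n) N N'"
    using E1 E2 E3 E4[OF ab(1)] E4[OF ab(2)] eventually_gt_at_top[of 0]
  proof eventually_elim
    case (elim n)
    show ?case
    proof (intro allI impI, elim conjE)
      fix N N'
      assume N: "(1 - \<epsilon>) * real n / 2 \<le> real N" "real N \<le> (1 + \<epsilon>) * real n / 2"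
        and N': "(1 - \<epsilon>) * real n / 2 \<le> real N'" "real N' \<le> (1 + \<epsilon>) * real n / 2"
      define L where "L = ln (real n)"
      have L: "1 \<le> L" using elim by (simp add: L_def)
      define z where "z = \<zeta> * L"
      have z: "0 \<le> z" "z + 1 \<le> c * L" using \<zeta>0 L by (auto simp: z_def c_def algebra_simps)
      have x: "d * L / real n * \<eta> < 1" "1 / (1 - d * L / real n * \<eta>) \<le> 1 + \<epsilon>"
        if "d > 0" "d * L / real n \<le> \<epsilon> / (1 + \<epsilon>)" for d
      proof -
        have "d * L / real n * \<eta> \<le> d * L / real n * 1"
          using that L \<eta> by (intro mult_left_mono) auto
        then have *: "d * L / real n * \<eta> \<le> \<epsilon> / (1 + \<epsilon>)" using that by simp
        also have "\<dots> < 1" using \<epsilon> by simp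
        finally show 1: "d * L / real n * \<eta> < 1" .
        have "1 / (1 + \<epsilon>) \<le> 1 - d * L / real n * \<eta>" using * \<epsilon> by (simp add: field_simps)
        then have "1 / (1 - d * L / real n * \<eta>) \<le> 1 / (1 / (1 + \<epsilon>))"
          using \<epsilon> 1 by (intro divide_left_mono) auto
        then show "1 / (1 - d * L / real n * \<eta>) \<le> 1 + \<epsilon>" by simp
      qed
      have mn: "real (nat \<lfloor>z\<rfloor>) \<le> \<epsilon> * real n / 2"
      proof -
        have "real (nat \<lfloor>z\<rfloor>) \<le> z" using z by simp
        also have "\<dots> \<le> c * L" using z by simp
        also have "\<dots> \<le> \<epsilon> * real n / 2" using elim by (simp add: L_def)
        finally show ?thesis .
      qed
      have "- \<theta> = - ?f \<epsilon> + - \<delta>" by (simp add: \<delta>_def)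
      then have "real n powr (- \<theta>) = real n powr (- ?f \<epsilon> + - \<delta>)" by (simp only:)
      also have "\<dots> = real n powr (- ?f \<epsilon>) * (1 / real n powr \<delta>)"
        unfolding powr_add powr_minus_divide[of _ \<delta>] ..
      also have "\<dots> \<le> real n powr (- ?f \<epsilon>) * (1 / (exp 4 * (z + 1)\<^sup>2))"
      proof (intro mult_left_mono divide_left_mono)
        have "exp 4 * (z + 1)\<^sup>2 \<le> exp 4 * (c * L)\<^sup>2"
          using z by (intro mult_left_mono power_mono) auto
        also have "\<dots> \<le> real n powr \<delta>" using elim by (simp add: L_def)
        finally show "exp 4 * (z + 1)\<^sup>2 \<le> real n powr \<delta>" .
        show "0 < real n powr \<delta> * (exp 4 * (z + 1)\<^sup>2)" using z elim by auto
      qed auto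
      also have "\<dots> = exp (- (?f \<epsilon> * L)) * exp (- 4) / (z + 1)\<^sup>2"
      proof -
        have "real n powr (- F) = exp (- (F * L))" for F
          using elim by (simp add: powr_def L_def)
        moreover have "(1 :: real) / (exp 4 * (z + 1)\<^sup>2) = exp (- 4) / (z + 1)\<^sup>2"
          by (simp add: exp_minus divide_inverse)
        ultimately show ?thesis by (simp only: times_divide_eq_right)
      qed
      also have "\<dots> \<le> good_prob \<alpha> \<eta> (a * L / real n) (b * L / real n) (nat \<lfloor>z\<rfloor>) N N'"
        using good_prob_ge[of \<epsilon> a b \<alpha> \<eta> L n N N'] \<epsilon> ab \<alpha> \<eta> L elim N N' mn x[OF ab(1)] x[OF ab(2)]
        by (simp add: z_def \<zeta>_def L_def)
      finally show "real n powr (- \<theta>) \<le>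
          good_prob \<alpha> \<eta> (a * ln (real n) / real n) (b * ln (real n) / real n) (m n) N N'"
        by (simp add: L_def m_def z_def)
    qed
  qed
  then show ?thesis using that \<epsilon> by blast
qed

subsection \<open>Concentration of the labels and conclusion\<close>

lemma card_plus_labels:
  assumes "B \<subseteq> {1..n}"
  shows "map_pmf (\<lambda>\<sigma>. card {i \<in> B. \<sigma> i = 1}) (uniform_labels n) = binomial_pmf (card B) (1 / 2)"
proof -
  have fin: "finite B" using assms finite_subset by blast
  have "map_pmf (\<lambda>x. x = 1) (pmf_of_set {1, -1 :: int}) = bernoulli_pmf (1 / 2)"
    unfolding bernoulli_pmf_half_conv_pmf_of_set
    by (subst map_pmf_of_set_inj) (auto simp: inj_on_def UNIV_bool intro!: arg_cong[where f = pmf_of_set])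
  then have "Pi_pmf {1..n} False (\<lambda>_. bernoulli_pmf (1 / 2)) =
             map_pmf (\<lambda>\<sigma>. (\<lambda>x. x = 1) \<circ> \<sigma>) (uniform_labels n)"
    unfolding uniform_labels_def by (subst Pi_pmf_map[symmetric]) auto
  then have "Pi_pmf B False (\<lambda>_. bernoulli_pmf (1 / 2)) =
             map_pmf (\<lambda>\<sigma> x. x \<in> B \<and> \<sigma> x = 1) (uniform_labels n)"
    by (subst Pi_pmf_subset[OF finite_atLeastAtMost assms])
       (auto simp: pmf.map_comp o_def intro!: map_pmf_cong)
  then have "binomial_pmf (card B) (1 / 2) = map_pmf (\<lambda>\<sigma>. card {i \<in> B. i \<in> B \<and> \<sigma> i = 1}) (uniform_labels n)"
    using binomial_pmf_altdef'[OF fin refl, of "1 / 2" False] by (simp add: pmf.map_comp o_def)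
  then show ?thesis by simp
qed

lemma label_concentration:
  assumes "B \<subseteq> {1..n}" "0 \<le> \<epsilon>"
  shows "measure_pmf.prob (uniform_labels n)
           {\<sigma>. \<epsilon> * real (card B) \<le> \<bar>real (card {i \<in> B. \<sigma> i = 1}) - real (card B) / 2\<bar>} \<le>
         2 * exp (- 2 * \<epsilon>\<^sup>2 * real (card B))"
proof (cases "card B = 0")
  case True
  have "measure_pmf.prob (uniform_labels n) Z \<le> 2" for Z
    by (rule order_trans[OF measure_pmf.prob_le_1]) simp
  then show ?thesis using True by simp
next
  case False
  let ?N = "card B"
  interpret binomial_distribution ?N "1 / 2" by standard auto
  have "measure_pmf.prob (uniform_labels n)
           {\<sigma>. \<epsilon> * real ?N \<le> \<bar>real (card {i \<in> B. \<sigma> i = 1}) - real ?N / 2\<bar>} =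
        measure_pmf.prob (map_pmf (\<lambda>\<sigma>. card {i \<in> B. \<sigma> i = 1}) (uniform_labels n))
           {x. \<bar>real x - real ?N * (1 / 2)\<bar> \<ge> \<epsilon> * real ?N}"
    by (simp add: vimage_def)
  also have "\<dots> \<le> 2 * exp (- 2 * (\<epsilon> * real ?N)\<^sup>2 / real ?N)"
    unfolding card_plus_labels[OF assms(1)] using assms(2) False by (intro prob_abs_ge) auto
  also have "- 2 * (\<epsilon> * real ?N)\<^sup>2 / real ?N = - 2 * \<epsilon>\<^sup>2 * real ?N"
    using False by (simp add: power2_eq_square)
  finally show ?thesis .
qed

lemma prob_bind_pmf_le:
  assumes "\<And>x. x \<in> set_pmf L \<Longrightarrow> x \<notin> Bad \<Longrightarrow> measure_pmf.prob (f x) Z \<le> \<delta>" and "0 \<le> \<delta>"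
  shows "measure_pmf.prob (bind_pmf L f) Z \<le> measure_pmf.prob L Bad + \<delta>"
proof -
  have int: "integrable (measure_pmf L) (\<lambda>x. indicator Bad x + \<delta>)"
    by (rule measure_pmf.integrable_const_bound[where B = "1 + \<delta>"])
       (use \<open>0 \<le> \<delta>\<close> in \<open>auto simp: indicator_def\<close>)
  have int': "integrable (measure_pmf L) (\<lambda>x. measure_pmf.prob (f x) Z)"
    by (rule measure_pmf.integrable_const_bound[where B = 1]) auto
  have "measure_pmf.prob (bind_pmf L f) Z = (\<integral>x. measure_pmf.prob (f x) Z \<partial>L)"
    by (rule prob_bind_pmf)
  also have "\<dots> \<le> (\<integral>x. indicator Bad x + \<delta> \<partial>L)"
  proof (rule integral_mono_AE[OF int' int], rule AE_pmfI)
    fix x assume "x \<in> set_pmf L"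
    moreover have "measure_pmf.prob (f x) Z \<le> 1" by simp
    ultimately show "measure_pmf.prob (f x) Z \<le> indicator Bad x + \<delta>"
      using assms(1)[of x] \<open>0 \<le> \<delta>\<close> by (cases "x \<in> Bad") (auto intro: order_trans)
  qed
  also have "\<dots> = measure_pmf.prob L Bad + \<delta>"
    by (subst Bochner_Integration.integral_add)
       (auto intro!: measure_pmf.integrable_const_bound[where B = 1])
  finally show ?thesis .
qed

text \<open>Disjoint blocks reduce counting to existence: one good vertex of each label per block
  already gives \<open>M\<close> different pairs, and a union bound over the \<open>2 * M\<close>
  choices of block and label suffices.\<close>

lemma prob_few_good_pairs_given_labels:
  assumes pq: "0 < p" "p < 1" "0 < q" "q < 1" and s: "0 \<le> s" "s \<le> 1" and T: "T \<subseteq> {1..K}"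
    and SR: "S \<union> R = {1..n}" "S \<inter> R = {}"
    and B: "\<And>k. k < M \<Longrightarrow> B k \<subseteq> S" "\<And>k l. k < M \<Longrightarrow> l < M \<Longrightarrow> k \<noteq> l \<Longrightarrow> B k \<inter> B l = {}"
    and lab: "\<And>u. u \<in> {1..n} \<Longrightarrow> \<sigma> u \<in> {1, -1}"
    and \<rho>: "\<And>l. l \<in> {1, -1} \<Longrightarrow> \<rho> \<le> good_prob ((1 - s) ^ card T - (1 - s) ^ K) (1 - (1 - s) ^ (K - card T)) p q m
              (card {u \<in> R. \<sigma> u = l}) (card {u \<in> R. \<sigma> u \<noteq> l})" "0 \<le> \<rho>"
    and N: "\<And>k l. k < M \<Longrightarrow> l \<in> {1, -1} \<Longrightarrow> N \<le> real (card {i \<in> B k. \<sigma> i = l})" "0 \<le> N"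
  shows "measure_pmf.prob (pattern_law K n p q s \<sigma>) {c. card (good_pairs T S R m \<sigma> c) < M} \<le>
         2 * real M * (exp (- \<rho> * N) + real (card S) * max p q)"
proof -
  let ?D = "pattern_law K n p q s \<sigma>"
  define X where "X = (\<lambda>(k, l). {c. \<forall>i\<in>{i \<in> B k. \<sigma> i = l}. \<not> good T S R m \<sigma> c i})"
  define I where "I = {..<M} \<times> {1, -1 :: int}"
  have finS: "finite S" using SR by (metis finite_Un finite_atLeastAtMost)
  have "{c. card (good_pairs T S R m \<sigma> c) < M} \<subseteq> (\<Union>x\<in>I. X x)"
  proof (rule subsetI, rule ccontr)
    fix c assume c: "c \<in> {c. card (good_pairs T S R m \<sigma> c) < M}" "c \<notin> (\<Union>x\<in>I. X x)"
    have ex: "\<exists>i. i \<in> B k \<and> \<sigma> i = l \<and> good T S R m \<sigma> c i" if "k < M" "l \<in> {1, -1}" for k l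
    proof -
      have "(k, l) \<in> I" using that by (auto simp: I_def)
      then have "c \<notin> X (k, l)" using c(2) by blast
      then show ?thesis by (auto simp: X_def)
    qed
    obtain f where f: "\<And>k. k < M \<Longrightarrow> f k \<in> B k \<and> \<sigma> (f k) = 1 \<and> good T S R m \<sigma> c (f k)"
      using ex[of _ 1] by (metis insertI1)
    obtain g where g: "\<And>k. k < M \<Longrightarrow> g k \<in> B k \<and> \<sigma> (g k) = -1 \<and> good T S R m \<sigma> c (g k)"
      using ex[of _ "-1"] by (metis insertI1 insertI2)
    have "inj_on (\<lambda>k. (f k, g k)) {..<M}"
    proof (rule inj_onI)
      fix k l assume kl: "k \<in> {..<M}" "l \<in> {..<M}" "(f k, g k) = (f l, g l)"
      then have "f k \<in> B k \<inter> B l" using f[of k] f[of l] by auto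
      then show "k = l" using B(2)[of k l] kl by blast
    qed
    then have "card ((\<lambda>k. (f k, g k)) ` {..<M}) = M" by (simp add: card_image)
    moreover have "(\<lambda>k. (f k, g k)) ` {..<M} \<subseteq> good_pairs T S R m \<sigma> c"
      using f g B(1) by (auto simp: good_pairs_def)
    moreover have "finite (good_pairs T S R m \<sigma> c)"
      by (rule finite_subset[of _ "S \<times> S"]) (use finS in \<open>auto simp: good_pairs_def\<close>)
    ultimately have "M \<le> card (good_pairs T S R m \<sigma> c)" by (metis card_mono)
    then show False using c(1) by simp
  qed
  then have "measure_pmf.prob ?D {c. card (good_pairs T S R m \<sigma> c) < M} \<le> measure_pmf.prob ?D (\<Union>x\<in>I. X x)"
    by (intro measure_pmf.finite_measure_mono) auto
  also have "\<dots> \<le> (\<Sum>x\<in>I. measure_pmf.prob ?D (X x))"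
    by (rule measure_UNION_le) (auto simp: I_def)
  also have "\<dots> \<le> (\<Sum>x\<in>I. exp (- \<rho> * N) + real (card S) * max p q)"
  proof (rule sum_mono)
    fix x assume x: "x \<in> I"
    obtain k l where kl: "x = (k, l)" by (cases x)
    then have k: "k < M" "l \<in> {1, -1}" using x by (auto simp: I_def)
    let ?g = "good_prob ((1 - s) ^ card T - (1 - s) ^ K) (1 - (1 - s) ^ (K - card T)) p q m
              (card {u \<in> R. \<sigma> u = l}) (card {u \<in> R. \<sigma> u \<noteq> l})"
    let ?B = "{i \<in> B k. \<sigma> i = l}"
    have "measure_pmf.prob ?D (X x) \<le> exp (- ?g * real (card ?B)) + real (card S) * max p q"
      unfolding X_def kl prod.case
      by (rule prob_no_good[OF pq s T SR]) (use B(1)[OF k(1)] in auto)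
    moreover have "\<rho> * N \<le> ?g * real (card ?B)"
      using \<rho>(1)[OF k(2)] \<rho>(2) N(1)[OF k] N(2) by (intro mult_mono) auto
    ultimately show "measure_pmf.prob ?D (X x) \<le> exp (- \<rho> * N) + real (card S) * max p q"
      by (smt (verit) exp_le_cancel_iff mult_minus_left)
  qed
  also have "\<dots> = 2 * real M * (exp (- \<rho> * N) + real (card S) * max p q)"
    by (simp add: I_def card_cartesian_product)
  finally show ?thesis .
qed

text \<open>Labels are drawn first and must be balanced twice: in \<open>R\<close> up to a relative
  error of order \<open>\<epsilon>\<close>, so that \<open>good_prob\<close> is bounded below, and
  in each block roughly enough that either label occurs on a quarter of it.\<close>

lemma prob_few_good_pairs:
  assumes pq: "0 < p" "p < 1" "0 < q" "q < 1" and s: "0 \<le> s" "s \<le> 1" and T: "T \<subseteq> {1..K}"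
    and n: "M * r \<le> n" "real (M * r) \<le> \<epsilon> / 2 * real n" and \<epsilon>: "0 < \<epsilon>" "\<epsilon> < 1"
    and \<rho>: "0 \<le> \<rho>" "\<And>N N'.
       (1 - \<epsilon>) * real n / 2 \<le> real N \<and> real N \<le> (1 + \<epsilon>) * real n / 2 \<and>
       (1 - \<epsilon>) * real n / 2 \<le> real N' \<and> real N' \<le> (1 + \<epsilon>) * real n / 2 \<Longrightarrow>
       \<rho> \<le> good_prob ((1 - s) ^ card T - (1 - s) ^ K) (1 - (1 - s) ^ (K - card T)) p q m N N'"
  defines "S \<equiv> {1..M * r}" and "R \<equiv> {M * r + 1..n}"
  shows "measure_pmf.prob (latent K n p q s) {(\<sigma>, c, \<pi>). card (good_pairs T S R m \<sigma> c) < M} \<le>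
     2 * exp (- 2 * (\<epsilon> / 4)\<^sup>2 * (real n - real (M * r))) + real M * (2 * exp (- 2 * (1 / 4)\<^sup>2 * real r)) +
     2 * real M * (exp (- \<rho> * (real r / 4)) + real (M * r) * max p q)"
proof -
  let ?L = "uniform_labels n"
  let ?\<delta> = "2 * real M * (exp (- \<rho> * (real r / 4)) + real (M * r) * max p q)"
  have SR: "S \<union> R = {1..n}" "S \<inter> R = {}" using n by (auto simp: S_def R_def)
  define B where "B = (\<lambda>k. {k * r + 1..Suc k * r})"
  have BS: "B k \<subseteq> S" if "k < M" for k
  proof -
    have "Suc k * r \<le> M * r" using that by (intro mult_le_mono1) simp
    then show ?thesis by (auto simp: B_def S_def simp del: mult_Suc)
  qed
  have Bdisj: "B k \<inter> B l = {}" if "k \<noteq> l" for k l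
  proof -
    have *: "B k \<inter> B l = {}" if "k < l" for k l
    proof -
      have "Suc k * r \<le> l * r" using that by (intro mult_le_mono1) simp
      then have "x \<notin> B l" if "x \<in> B k" for x
        using that unfolding B_def atLeastAtMost_iff by linarith
      then show ?thesis by blast
    qed
    show ?thesis using *[of k l] *[of l k] that by (cases "k < l") auto
  qed
  have cardB: "card (B k) = r" for k by (simp add: B_def)
  have cardR: "real (card R) = real n - real (M * r)" using n by (simp add: R_def)
  have cardS: "card S = M * r" by (simp add: S_def)
  define dev where "dev = (\<lambda>Z \<epsilon>. {\<sigma> :: nat \<Rightarrow> int. \<epsilon> * real (card Z) \<le> \<bar>real (card {i \<in> Z. \<sigma> i = 1}) - real (card Z) / 2\<bar>})"
  define Bad where "Bad = dev R (\<epsilon> / 4) \<union> (\<Union>k<M. dev (B k) (1 / 4))"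
  have "measure_pmf.prob ?L Bad \<le> measure_pmf.prob ?L (dev R (\<epsilon> / 4)) + measure_pmf.prob ?L (\<Union>k<M. dev (B k) (1 / 4))"
    unfolding Bad_def by (rule measure_Un_le) auto
  also have "\<dots> \<le> measure_pmf.prob ?L (dev R (\<epsilon> / 4)) + (\<Sum>k<M. measure_pmf.prob ?L (dev (B k) (1 / 4)))"
    by (intro add_left_mono measure_UNION_le) auto
  also have "\<dots> \<le> 2 * exp (- 2 * (\<epsilon> / 4)\<^sup>2 * real (card R)) + (\<Sum>k<M. 2 * exp (- 2 * (1 / 4)\<^sup>2 * real r))"
  proof (intro add_mono sum_mono)
    show "measure_pmf.prob ?L (dev R (\<epsilon> / 4)) \<le> 2 * exp (- 2 * (\<epsilon> / 4)\<^sup>2 * real (card R))"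
      unfolding dev_def by (rule label_concentration) (use SR \<epsilon> in auto)
    fix k assume "k \<in> {..<M}"
    then have "B k \<subseteq> {1..n}" using BS SR by blast
    then show "measure_pmf.prob ?L (dev (B k) (1 / 4)) \<le> 2 * exp (- 2 * (1 / 4)\<^sup>2 * real r)"
      using label_concentration[of "B k" n "1 / 4"] by (simp add: dev_def cardB)
  qed
  also have "\<dots> = 2 * exp (- 2 * (\<epsilon> / 4)\<^sup>2 * (real n - real (M * r))) + real M * (2 * exp (- 2 * (1 / 4)\<^sup>2 * real r))"
    unfolding cardR by simp
  finally have bad: "measure_pmf.prob ?L Bad \<le> \<dots>" .
  define f where "f = (\<lambda>\<sigma>. do {c \<leftarrow> pattern_law K n p q s \<sigma>; \<pi> \<leftarrow> perm_law K n; return_pmf (\<sigma>, c, \<pi>)})"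
  let ?Z = "{(\<sigma>, c, \<pi> :: nat \<Rightarrow> nat \<Rightarrow> nat). card (good_pairs T S R m \<sigma> c) < M}"
  have "measure_pmf.prob (bind_pmf ?L f) ?Z \<le> measure_pmf.prob ?L Bad + ?\<delta>"
  proof (rule prob_bind_pmf_le)
    fix \<sigma> assume \<sigma>: "\<sigma> \<in> set_pmf ?L" "\<sigma> \<notin> Bad"
    have lab: "\<sigma> u \<in> {1, -1}" if "u \<in> {1..n}" for u by (rule labels_in_support[OF \<sigma>(1) that])
    have minus: "{u \<in> Z. \<sigma> u = -1} = {u \<in> Z. \<sigma> u \<noteq> 1}" "{u \<in> Z. \<sigma> u \<noteq> -1} = {u \<in> Z. \<sigma> u = 1}"
      if "Z \<subseteq> {1..n}" for Z
      using lab that by force+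
    have compl: "real (card {u \<in> Z. \<sigma> u \<noteq> 1}) = real (card Z) - real (card {u \<in> Z. \<sigma> u = 1})"
      if "Z \<subseteq> {1..n}" for Z
    proof -
      have "finite Z" using that finite_subset by blast
      then have "card Z = card {u \<in> Z. \<sigma> u = 1} + card {u \<in> Z. \<sigma> u \<noteq> 1}"
        by (subst card_Un_disjoint[symmetric]) (auto intro: arg_cong[where f = card])
      then show ?thesis by simp
    qed
    have Rn: "R \<subseteq> {1..n}" using SR by blast
    let ?N = "card {u \<in> R. \<sigma> u = 1}" and ?N' = "card {u \<in> R. \<sigma> u \<noteq> 1}"
    have range: "(1 - \<epsilon>) * real n / 2 \<le> real ?N" "real ?N \<le> (1 + \<epsilon>) * real n / 2"
      "(1 - \<epsilon>) * real n / 2 \<le> real ?N'" "real ?N' \<le> (1 + \<epsilon>) * real n / 2"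
    proof -
      have "\<bar>real ?N - real (card R) / 2\<bar> < \<epsilon> / 4 * real (card R)"
        using \<sigma>(2) by (auto simp: Bad_def dev_def not_le)
      then have "real ?N - real (card R) / 2 < \<epsilon> / 4 * real (card R)"
        "- (\<epsilon> / 4 * real (card R)) < real ?N - real (card R) / 2" by linarith+
      then have d: "(1 / 2 - \<epsilon> / 4) * real (card R) \<le> real ?N" "real ?N \<le> (1 / 2 + \<epsilon> / 4) * real (card R)"
        "(1 / 2 - \<epsilon> / 4) * real (card R) \<le> real ?N'" "real ?N' \<le> (1 / 2 + \<epsilon> / 4) * real (card R)"
        unfolding compl[OF Rn] left_diff_distrib distrib_right by linarith+
      have "(1 - \<epsilon>) * real n / 2 \<le> (1 / 2 - \<epsilon> / 4) * ((1 - \<epsilon> / 2) * real n)"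
      proof -
        \<comment> \<open>Half of the tolerance is spent on the label fluctuation in
          \<open>R\<close>, the other half on the vertices of \<open>S\<close> missing from
          \<open>R\<close>.\<close>
        have "(1 - \<epsilon>) / 2 + \<epsilon> * \<epsilon> / 8 = (1 / 2 - \<epsilon> / 4) * (1 - \<epsilon> / 2)" by (simp add: field_simps)
        then have "(1 - \<epsilon>) / 2 \<le> (1 / 2 - \<epsilon> / 4) * (1 - \<epsilon> / 2)"
          using zero_le_square[of \<epsilon>] by linarith
        then have "(1 - \<epsilon>) / 2 * real n \<le> (1 / 2 - \<epsilon> / 4) * (1 - \<epsilon> / 2) * real n"
          by (rule mult_right_mono) simp
        then show ?thesis by (simp add: mult.assoc)
      qed
      also have "\<dots> \<le> (1 / 2 - \<epsilon> / 4) * real (card R)"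
        using n \<epsilon> by (intro mult_left_mono) (auto simp: cardR algebra_simps)
      finally have lo: "(1 - \<epsilon>) * real n / 2 \<le> (1 / 2 - \<epsilon> / 4) * real (card R)" .
      have "(1 / 2 + \<epsilon> / 4) * real (card R) \<le> ((1 + \<epsilon>) / 2) * real n"
        using \<epsilon> cardR by (intro mult_mono) simp_all
      then have up: "(1 / 2 + \<epsilon> / 4) * real (card R) \<le> (1 + \<epsilon>) * real n / 2" by simp
      show "(1 - \<epsilon>) * real n / 2 \<le> real ?N" "real ?N \<le> (1 + \<epsilon>) * real n / 2"
        "(1 - \<epsilon>) * real n / 2 \<le> real ?N'" "real ?N' \<le> (1 + \<epsilon>) * real n / 2"
        using d lo up by linarith+
    qed
    have "map_pmf (\<lambda>(\<sigma>, c, \<pi>). c) (f \<sigma>) = pattern_law K n p q s \<sigma>"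
      by (simp add: f_def map_bind_pmf bind_return_pmf')
    \<comment> \<open>\<open>f \<sigma>\<close> returns the labelling \<open>\<sigma>\<close>
      itself, so the labels in the event may be frozen.\<close>
    moreover have "measure_pmf.prob (f \<sigma>) ?Z =
        measure_pmf.prob (map_pmf (\<lambda>(\<sigma>, c, \<pi>). c) (f \<sigma>)) {c. card (good_pairs T S R m \<sigma> c) < M}"
      unfolding measure_map_pmf
      by (rule measure_prob_cong_0) (auto simp: f_def set_pmf_iff[symmetric] pmf_eq_0_set_pmf)
    ultimately have "measure_pmf.prob (f \<sigma>) ?Z =
        measure_pmf.prob (pattern_law K n p q s \<sigma>) {c. card (good_pairs T S R m \<sigma> c) < M}" by simp
    also have "\<dots> \<le> 2 * real M * (exp (- \<rho> * (real r / 4)) + real (card S) * max p q)"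
    proof (rule prob_few_good_pairs_given_labels[OF pq s T SR BS Bdisj lab])
      show "\<rho> \<le> good_prob ((1 - s) ^ card T - (1 - s) ^ K) (1 - (1 - s) ^ (K - card T)) p q m
              (card {u \<in> R. \<sigma> u = l}) (card {u \<in> R. \<sigma> u \<noteq> l})" if "l \<in> {1, -1}" for l
        using that range by (auto simp: minus[OF Rn] intro!: \<rho>(2))
      show "real r / 4 \<le> real (card {i \<in> B k. \<sigma> i = l})" if "k < M" "l \<in> {1, -1}" for k l
      proof -
        have Bn: "B k \<subseteq> {1..n}" using BS[OF that(1)] SR by blast
        have "\<bar>real (card {i \<in> B k. \<sigma> i = 1}) - real r / 2\<bar> < 1 / 4 * real r"
          using \<sigma>(2) that(1) by (auto simp: Bad_def dev_def not_le cardB)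
        then have "real r / 4 \<le> real (card {i \<in> B k. \<sigma> i = 1})" "real r / 4 \<le> real (card {i \<in> B k. \<sigma> i \<noteq> 1})"
          unfolding compl[OF Bn] cardB by linarith+
        then show ?thesis using that(2) by (auto simp: minus[OF Bn])
      qed
    qed (use \<rho> in auto)
    finally show "measure_pmf.prob (f \<sigma>) ?Z \<le> ?\<delta>" by (simp only: cardS)
  next
    show "0 \<le> ?\<delta>" using pq by (intro mult_nonneg_nonneg add_nonneg_nonneg) auto
  qed
  moreover have "bind_pmf ?L f = latent K n p q s" by (simp add: latent_def f_def)
  ultimately show ?thesis using bad by simp
qed

section \<open>Choice of the parameters and passage to the limit\<close>

lemma recovery_prob_tendsto_0:
  fixes est :: "nat \<Rightarrow> (nat \<Rightarrow> graph) \<Rightarrow> nat \<Rightarrow> int"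
  assumes ab: "a > 0" "b > 0" and s: "0 \<le> s" "s \<le> 1" and T: "T \<subseteq> {2..K}"
    and thr: "(1 - (1 - s) ^ (K - card T)) * (a + b) / 2 -
              ((1 - s) ^ card T - (1 - s) ^ K) * sqrt (a * b) < 1"
    and est: "\<And>n G i. i \<in> {1..n} \<Longrightarrow> est n G i \<in> {1, -1}"
  shows "(\<lambda>n. measure_pmf.prob
            (CSBM K n (a * ln (real n) / real n) (b * ln (real n) / real n) s)
            {(\<sigma>, G). ov n (est n G) \<sigma> = 1}) \<longlonglongrightarrow> 0"
    (is "?P \<longlonglongrightarrow> 0")
proof -
  define \<alpha> where "\<alpha> = (1 - s) ^ card T - (1 - s) ^ K"
  define \<eta> where "\<eta> = 1 - (1 - s) ^ (K - card T)"
  have TK: "T \<subseteq> {1..K}" using T by auto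
  then have "card T \<le> K" using card_mono[of "{1..K}" T] by simp
  then have \<alpha>0: "0 \<le> \<alpha>" using s by (simp add: \<alpha>_def power_decreasing)
  have \<eta>01: "0 \<le> \<eta>" "\<eta> \<le> 1" using s by (auto simp: \<eta>_def power_le_one)
  \<comment> \<open>Midway between the threshold and 1; the maximum with 0 keeps
    \<open>\<theta>\<close> positive even if the threshold expression is negative.\<close>
  define \<theta> where "\<theta> = (max 0 (\<eta> * (a + b) / 2 - \<alpha> * sqrt (a * b)) + 1) / 2"
  have \<theta>: "\<eta> * (a + b) / 2 - \<alpha> * sqrt (a * b) < \<theta>" "0 < \<theta>" "\<theta> < 1"
    using thr unfolding \<theta>_def \<alpha>_def[symmetric] \<eta>_def[symmetric] by (auto simp: max_def)
  \<comment> \<open>Blocks of n^\<kappa> vertices: \<kappa> > \<theta> makes the expected number of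
    good vertices per block diverge, \<kappa> < 1 makes parent edges from a given vertex into the
    blocks unlikely.\<close>
  define \<kappa> where "\<kappa> = (1 + \<theta>) / 2"
  have \<kappa>: "\<theta> < \<kappa>" "0 < \<kappa>" "\<kappa> < 1" using \<theta> by (auto simp: \<kappa>_def)
  obtain \<epsilon> m where \<epsilon>: "0 < \<epsilon>" "\<epsilon> < 1 / 2" and gp:
    "\<forall>\<^sub>F n in sequentially. \<forall>N N'.
       (1 - \<epsilon>) * real n / 2 \<le> real N \<and> real N \<le> (1 + \<epsilon>) * real n / 2 \<and>
       (1 - \<epsilon>) * real n / 2 \<le> real N' \<and> real N' \<le> (1 + \<epsilon>) * real n / 2 \<longrightarrow>
       real n powr (- \<theta>) \<le> good_prob \<alpha> \<eta> (a * ln (real n) / real n) (b * ln (real n) / real n) (m n) N N'"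
    by (rule good_prob_asymp[OF ab \<alpha>0 \<eta>01 \<theta>(1)])
  define c where "c = max a b"
  have c: "c > 0" using ab by (simp add: c_def)
  \<comment> \<open>The bound of \<open>prob_few_good_pairs\<close> with the block size
    \<open>r\<close> estimated between \<open>real n powr \<kappa> / 2\<close> and
    \<open>real n powr \<kappa>\<close>, and the size of \<open>R\<close> by at least
    \<open>n / 2\<close>.\<close>
  define g where "g = (\<lambda>(M::real) (n::nat).
    2 * exp (- 2 * (\<epsilon> / 4)\<^sup>2 * (real n / 2)) + M * (2 * exp (- 2 * (1 / 4)\<^sup>2 * (real n powr \<kappa> / 2))) +
    2 * M * (exp (- (real n powr (- \<theta>)) * (real n powr \<kappa> / 8)) + M * real n powr \<kappa> * (c * ln (real n) / real n)))"
  have g0: "g M \<longlonglongrightarrow> 0" if "M > 0" for M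
  proof -
    have "\<kappa> - \<theta> > 0" using \<kappa> by simp
    have "(\<lambda>n. 2 * exp (- 2 * (\<epsilon> / 4)\<^sup>2 * (real n / 2))) \<longlonglongrightarrow> 0" using \<epsilon>(1) by real_asymp
    moreover have "(\<lambda>n. M * (2 * exp (- 2 * (1 / 4)\<^sup>2 * (real n powr \<kappa> / 2)))) \<longlonglongrightarrow> 0"
      using \<kappa>(2) by real_asymp
    moreover have "(\<lambda>n. exp (- (real n powr (- \<theta>)) * (real n powr \<kappa> / 8))) \<longlonglongrightarrow> 0"
    proof -
      have "(\<lambda>n. exp (- (real n powr (\<kappa> - \<theta>) / 8))) \<longlonglongrightarrow> 0"
        using \<open>\<kappa> - \<theta> > 0\<close> by real_asymp
      then show ?thesis by (simp add: powr_add[symmetric])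
    qed
    moreover have "(\<lambda>n. M * real n powr \<kappa> * (c * ln (real n) / real n)) \<longlonglongrightarrow> 0"
      using \<kappa>(3) c by real_asymp
    ultimately have "g M \<longlonglongrightarrow> 0 + 0 + 2 * M * (0 + 0)"
      unfolding g_def by (intro tendsto_intros)
    then show ?thesis by simp
  qed
  have bound: "\<forall>\<^sub>F n in sequentially. ?P n \<le> 2 / real M + g (real M) n" if "M > 0" for M :: nat
  proof -
    have Mpos: "real M > 0" using that by simp
    have small: "\<forall>\<^sub>F n in sequentially. d * ln (real n) / real n < 1" for d by real_asymp
    have pos: "\<forall>\<^sub>F n in sequentially. 0 < d * ln (real n) / real n" if "d > 0" for d
      using that by real_asymp
    have E1: "\<forall>\<^sub>F n in sequentially. real M * real n powr \<kappa> \<le> \<epsilon> / 2 * real n"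
      using Mpos \<epsilon>(1) \<kappa> by real_asymp
    have E2: "\<forall>\<^sub>F n in sequentially. 2 \<le> real n powr \<kappa>" using \<kappa>(2) by real_asymp
    show ?thesis
      using gp small[of a] small[of b] pos[OF ab(1)] pos[OF ab(2)] E1 E2 eventually_gt_at_top[of 0]
    proof eventually_elim
      case (elim n)
      define p where "p = a * ln (real n) / real n"
      define q where "q = b * ln (real n) / real n"
      have pq: "0 < p" "p < 1" "0 < q" "q < 1" using elim by (auto simp: p_def q_def)
      define r where "r = nat \<lfloor>real n powr \<kappa>\<rfloor>"
      have r: "real r \<le> real n powr \<kappa>" "real n powr \<kappa> / 2 \<le> real r"
      proof -
        show "real r \<le> real n powr \<kappa>" by (simp add: r_def)
        have "real n powr \<kappa> - 1 \<le> real r" unfolding r_def by linarith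
        then show "real n powr \<kappa> / 2 \<le> real r" using elim by linarith
      qed
      have Mr: "real (M * r) \<le> real M * real n powr \<kappa>" using r by (simp add: mult_left_mono)
      then have Mr\<epsilon>: "real (M * r) \<le> \<epsilon> / 2 * real n" using elim by linarith
      also have "\<dots> \<le> 1 / 2 * real n" using \<epsilon> by (intro mult_right_mono) auto
      finally have Mr2: "real (M * r) \<le> real n / 2" by simp
      then have Mrn: "M * r \<le> n" by linarith
      define S where "S = {1..M * r}"
      define R where "R = {M * r + 1..n}"
      have SR: "S \<union> R = {1..n}" "S \<inter> R = {}" using Mrn by (auto simp: S_def R_def)
      let ?few = "measure_pmf.prob (latent K n p q s) {(\<sigma>, c, \<pi>). card (good_pairs T S R (m n) \<sigma> c) < M}"
      have "?P n \<le> 2 / real M + ?few"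
        unfolding p_def[symmetric] q_def[symmetric]
        by (rule prob_recovery_le[OF pq s T SR elim(8) that est])
      also have "?few \<le> 2 * exp (- 2 * (\<epsilon> / 4)\<^sup>2 * (real n - real (M * r))) + real M * (2 * exp (- 2 * (1 / 4)\<^sup>2 * real r)) +
          2 * real M * (exp (- (real n powr (- \<theta>)) * (real r / 4)) + real (M * r) * max p q)"
        unfolding S_def R_def
        by (rule prob_few_good_pairs[OF pq s TK Mrn Mr\<epsilon> \<epsilon>(1)])
           (use \<epsilon> elim(1) in \<open>auto simp: \<alpha>_def \<eta>_def p_def q_def\<close>)
      also have "\<dots> \<le> g (real M) n"
        unfolding g_def
      proof (intro add_mono mult_left_mono)
        have "2 * (\<epsilon> / 4)\<^sup>2 * (real n / 2) \<le> 2 * (\<epsilon> / 4)\<^sup>2 * (real n - real (M * r))"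
          using Mr2 by (intro mult_left_mono) auto
        then show "exp (- 2 * (\<epsilon> / 4)\<^sup>2 * (real n - real (M * r))) \<le> exp (- 2 * (\<epsilon> / 4)\<^sup>2 * (real n / 2))"
          by simp
        show "exp (- 2 * (1 / 4)\<^sup>2 * real r) \<le> exp (- 2 * (1 / 4)\<^sup>2 * (real n powr \<kappa> / 2))"
          using r by simp
        have "real n powr (- \<theta>) * (real n powr \<kappa> / 8) \<le> real n powr (- \<theta>) * (real r / 4)"
          using r by (intro mult_left_mono) auto
        then show "exp (- (real n powr (- \<theta>)) * (real r / 4)) \<le>
                   exp (- (real n powr (- \<theta>)) * (real n powr \<kappa> / 8))" by simp
        have "ln (real n) \<ge> 0" using elim by simp
        then have "max p q \<le> c * ln (real n) / real n"
          by (auto simp: p_def q_def c_def intro!: divide_right_mono mult_right_mono)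
        then show "real (M * r) * max p q \<le> real M * real n powr \<kappa> * (c * ln (real n) / real n)"
          using Mr pq by (intro mult_mono) auto
      qed auto
      finally show ?case by simp
    qed
  qed
  show ?thesis
  proof (rule LIMSEQ_I)
    fix e :: real assume e: "e > 0"
    \<comment> \<open>\<open>M\<close> is fixed before \<open>n\<close> tends to infinity: it makes
      the term \<open>2 / M\<close> smaller than \<open>e / 2\<close>, and all other terms vanish
      for fixed \<open>M\<close>.\<close>
    obtain M :: nat where M: "4 / e < real M" using reals_Archimedean2 by blast
    have "0 < 4 / e" using e by simp
    then have "0 < real M" using M by linarith
    then have M0: "M > 0" by simp
    then have "2 / real M < e / 2" using M e by (simp add: field_simps)
    have "\<forall>\<^sub>F n in sequentially. g (real M) n < e / 2"
      using g0[of "real M"] M0 e by (intro order_tendstoD(2)) auto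
    with bound[OF M0] have "\<forall>\<^sub>F n in sequentially. norm (?P n - 0) < e"
    proof eventually_elim
      case (elim n)
      then show ?case using \<open>2 / real M < e / 2\<close> by simp
    qed
    then show "\<exists>no. \<forall>n\<ge>no. norm (?P n - 0) < e" by (simp add: eventually_sequentially)
  qed
qed

theorem theorem2:
  fixes K :: nat and a b s :: real
    and est :: "nat \<Rightarrow> (nat \<Rightarrow> graph) \<Rightarrow> nat \<Rightarrow> int"
  assumes "K \<ge> 2" and "a > 0" and "b > 0" and "0 \<le> s" and "s \<le> 1"
    and "(1 - (1 - s) ^ K) * D_plus a b < 1 \<or>
         s * (1 - (1 - s) ^ (K - 1)) * T_c a b + s * (1 - s) ^ (K - 1) * D_plus a b < 1"
    and "\<And>n G i. i \<in> {1..n} \<Longrightarrow> est n G i \<in> {1, -1}"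
  shows "(\<lambda>n. measure_pmf.prob
            (CSBM K n (a * ln (real n) / real n) (b * ln (real n) / real n) s)
            {(\<sigma>, G). ov n (est n G) \<sigma> = 1}) \<longlonglongrightarrow> 0"
proof -
  have D: "D_plus a b = (a + b) / 2 - sqrt (a * b)"
    using assms(2,3) by (simp add: D_plus_def power2_diff real_sqrt_mult field_simps)
  obtain T where T: "T \<subseteq> {2..K}"
    and thr: "(1 - (1 - s) ^ (K - card T)) * (a + b) / 2 -
              ((1 - s) ^ card T - (1 - s) ^ K) * sqrt (a * b) < 1"
    using assms(6)
  proof
    assume "(1 - (1 - s) ^ K) * D_plus a b < 1"
    \<comment> \<open>With empty \<open>T\<close>, both coefficients equal 1 - (1-s)^K, and the
      difference of the two means is \<open>D_plus a b\<close>.\<close>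
    then show ?thesis by (intro that[of "{}"]) (simp_all add: D right_diff_distrib)
  next
    assume *: "s * (1 - (1 - s) ^ (K - 1)) * T_c a b + s * (1 - s) ^ (K - 1) * D_plus a b < 1"
    define x where "x = (1 - s) ^ (K - 1)"
    have K: "(1 - s) ^ K = (1 - s) * x" "K - (K - 1) = 1" "card {2..K} = K - 1"
      using assms(1) by (auto simp: x_def power_eq_if)
    \<comment> \<open>Only graph 1 lies outside \<open>T\<close>, so \<eta> = s and \<alpha> = s x.
      The hypothesis regroups because \<open>D_plus a b\<close> is \<open>T_c a b\<close> minus the
      geometric mean.\<close>
    have "s * (1 - x) * T_c a b + s * x * D_plus a b =
          (1 - (1 - s) ^ 1) * (a + b) / 2 - (x - (1 - s) * x) * sqrt (a * b)"
      by (simp add: D T_c_def field_simps)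
    then show ?thesis
      using * unfolding x_def[symmetric] by (intro that[of "{2..K}"]) (simp_all only: K x_def[symmetric] order.refl)
  qed
  show ?thesis
    by (rule recovery_prob_tendsto_0[OF assms(2-5) T thr assms(7)])
qed

end
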